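(* Let $T$ be a non-degenerate Calderón–Zygmund operator on $\mathbb{R}^n$. Let $m\in\mathbb{Z}_+=\{0,1,2,\dots\}$ and $p>1$, $\frac1p+\frac1{p'}=1$, and let $u,v$ be weights on $\mathbb{R}^n$. Assume that for every $b\in BMO$, $$\|T_b^mf\|_{L^{p,\infty}(u)}\lesssim\|b\|_{BMO}^m\|f\|_{L^p(v)}$$ (with a constant independent of $b$ and $f$). Assume additionally that $u$ is a doubling weight. Then $$\sup_Q\|u^{1/p}\|_{L^p,Q}\,\|v^{-1/p}\|_{L^{p'}(\log L)^{mp'},Q}<\infty,$$ where the supremum is over all cubes $Q$.
   Context: A weight is a non-negative locally integrable function on $\mathbb{R}^n$. $L^p(w)$ has norm $(\int|f|^pw)^{1/p}$ and $L^{p,\infty}(u)$ is the weak $L^p$ space with respect to $u\,dx$. A cube is a half-open cube $\prod_{i=1}^n[a_i,a_i+h)$, $h>0$; $f_Q=\frac1{|Q|}\int_Qf$. $v^{-1/p}=+\infty$ where $v=0$, and $0\cdot\infty=0$. A weight $u$ is doubling if there is $c>0$ with $u(2Q)\le c\,u(Q)$ for every cube $Q$, where $u(E)=\int_Eu$. $\|f\|_{\varphi,Q}=\inf\{\lambda>0:\frac1{|Q|}\int_Q\varphi(|f(y)|/\lambda)dy\le1\}$, written $\|f\|_{L^p(\log L)^\alpha,Q}$ when $\varphi(t)=t^p\log^\alpha(e+t)$ and $\|f\|_{L^p,Q}$ when $\varphi(t)=t^p$. $K$ is an $\omega$-Calderón–Zygmund kernel if $|K(x,y)|\le\frac{C_K}{|x-y|^n}$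 for $x\ne y$, and $|K(x,y)-K(x',y)|+|K(y,x)-K(y,x')|\le\omega\big(\frac{|x-x'|}{|x-y|}\big)\frac1{|x-y|^n}$ whenever $|x-y|>2|x-x'|$, where $\omega:[0,1]\to[0,\infty)$ is a modulus of continuity. An $\omega$-Calderón–Zygmund operator $T$ is a linear $L^2$-bounded operator with $Tf(x)=\int K(x,y)f(y)dy$ for all $x\notin\operatorname{supp}f$, with $K$ such a kernel. The kernel $K$ is non-degenerate if $\omega(t)\to0$ as $t\to0$ and there is $c_0>0$ such that for every $y\in\mathbb{R}^n$ and $r>0$ there exists $x\notin B(y,r)$ with $|K(x,y)|\ge\frac{c_0}{r^n}$. $T$ is a non-degenerate Calderón–Zygmund operator if both $K(x,y)$ and $\tilde K(x,y)=K(y,x)$ are non-degenerate. $[b,T]f=bT(f)-T(bf)$, $T_b^0=T$, $T_b^1=[b,T]$, $T_b^mf=[b,T_b^{m-1}]f$. $\|b\|_{BMO}=\sup_Q\frac1{|Q|}\int_Q|b-b_Q|$. The estimate for $T_b^mf$ is understood for bounded compactly supported $f$. *)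

theory Defs
  imports "HOL-Analysis.Analysis"
begin

text \<open>
  Measurability and integration refer to Lebesgue measure \<open>lebesgue\<close>. Norms and suprema
  of nonnegative quantities take values in \<open>ennreal\<close>, where \<open>0 * \<infinity> = 0\<close>. Kernels and functions
  take values in a scalar field \<open>'k\<close> of sort
  \<open>{real_normed_field, banach, second_countable_topology}\<close>, which covers both the real and the
  complex theory.
\<close>

text \<open>Only used with exponents \<open>a > 0\<close>.\<close>
definition enn_powr :: "ennreal \<Rightarrow> real \<Rightarrow> ennreal" where
  "enn_powr t a = (if t = \<infinity> then \<infinity> else ennreal (enn2real t powr a))"

definition cube :: "real ^ 'n \<Rightarrow> real \<Rightarrow> (real ^ 'n) set" where
  "cube a h = {x. \<forall>i. a $ i \<le> x $ i \<and> x $ i < a $ i + h}"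

definition cubes :: "(real ^ 'n) set set" where
  "cubes = {cube a h | a h. h > 0}"

definition avg :: "(real ^ 'n \<Rightarrow> real) \<Rightarrow> (real ^ 'n) set \<Rightarrow> real" where
  "avg f Q = (LINT x:Q|lebesgue. f x) / measure lebesgue Q"

definition enn_avg :: "(real ^ 'n \<Rightarrow> ennreal) \<Rightarrow> (real ^ 'n) set \<Rightarrow> ennreal" where
  "enn_avg g Q = (\<integral>\<^sup>+ x \<in> Q. g x \<partial>lebesgue) / emeasure lebesgue Q"

definition locally_integrable :: "(real ^ 'n \<Rightarrow> real) \<Rightarrow> bool" where
  "locally_integrable f \<longleftrightarrow> (\<forall>S. compact S \<longrightarrow> f absolutely_integrable_on S)"

definition weight :: "(real ^ 'n \<Rightarrow> real) \<Rightarrow> bool" where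
  "weight w \<longleftrightarrow> (\<forall>x. 0 \<le> w x) \<and> locally_integrable w"

definition wmeas :: "(real ^ 'n \<Rightarrow> real) \<Rightarrow> (real ^ 'n) set \<Rightarrow> ennreal" where
  "wmeas u E = (\<integral>\<^sup>+ x \<in> E. ennreal (u x) \<partial>lebesgue)"

text \<open>\<open>2Q\<close> is the cube with the same centre as \<open>Q\<close> and twice its side length.\<close>
definition doubling :: "(real ^ 'n \<Rightarrow> real) \<Rightarrow> bool" where
  "doubling u \<longleftrightarrow> (\<exists>c>0::real. \<forall>a h. h > 0 \<longrightarrow>
     wmeas u (cube (\<chi> i. a $ i - h / 2) (2 * h)) \<le> ennreal c * wmeas u (cube a h))"

definition lp_norm :: "real \<Rightarrow> (real ^ 'n \<Rightarrow> real) \<Rightarrow> (real ^ 'n \<Rightarrow> 'k::real_normed_vector) \<Rightarrow> ennreal"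
  where "lp_norm p w f = enn_powr (\<integral>\<^sup>+ x. ennreal (norm (f x) powr p * w x) \<partial>lebesgue) (1 / p)"

definition weak_lp_norm ::
  "real \<Rightarrow> (real ^ 'n \<Rightarrow> real) \<Rightarrow> (real ^ 'n \<Rightarrow> 'k::real_normed_vector) \<Rightarrow> ennreal" where
  "weak_lp_norm p u g = (SUP t\<in>{0<..}. ennreal t * enn_powr (wmeas u {x. norm (g x) > t}) (1 / p))"

text \<open>\<open>\<parallel>g\<parallel>\<^bsub>\<phi>,Q\<^esub>\<close> for \<open>g\<close> with values in \<open>[0,\<infinity>]\<close>; the infimum of the empty set is \<open>\<infinity>\<close>.\<close>
definition luxemburg ::
  "(ennreal \<Rightarrow> ennreal) \<Rightarrow> (real ^ 'n) set \<Rightarrow> (real ^ 'n \<Rightarrow> ennreal) \<Rightarrow> ennreal" where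
  "luxemburg \<phi> Q g = Inf {ennreal l | l. l > 0 \<and> enn_avg (\<lambda>y. \<phi> (g y / ennreal l)) Q \<le> 1}"

definition llog :: "real \<Rightarrow> real \<Rightarrow> ennreal \<Rightarrow> ennreal" where
  "llog p \<alpha> t = (if t = \<infinity> then \<infinity>
     else ennreal (enn2real t powr p * ln (exp 1 + enn2real t) powr \<alpha>))"

text \<open>The function \<open>v powr (-1/p)\<close>, equal to \<open>\<infinity>\<close> where \<open>v = 0\<close>.\<close>
definition inv_root :: "real \<Rightarrow> (real ^ 'n \<Rightarrow> real) \<Rightarrow> real ^ 'n \<Rightarrow> ennreal" where
  "inv_root p v x = (if v x = 0 then \<infinity> else ennreal (v x powr (- 1 / p)))"

definition bmo_norm :: "(real ^ 'n \<Rightarrow> real) \<Rightarrow> ennreal" where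
  "bmo_norm b = (SUP Q\<in>cubes. enn_avg (\<lambda>x. ennreal \<bar>b x - avg b Q\<bar>) Q)"

definition BMO :: "(real ^ 'n \<Rightarrow> real) set" where
  "BMO = {b. locally_integrable b \<and> bmo_norm b < \<infinity>}"

text \<open>Continuity at \<open>0\<close> is not included here; it is part of non-degeneracy below and,
  together with the conditions here, implies continuity on \<open>[0,1]\<close>.\<close>
definition modulus_of_continuity :: "(real \<Rightarrow> real) \<Rightarrow> bool" where
  "modulus_of_continuity \<omega> \<longleftrightarrow>
     \<omega> 0 = 0 \<and> (\<forall>t\<in>{0..1}. 0 \<le> \<omega> t) \<and> mono_on {0..1} \<omega> \<and>
     (\<forall>s t. 0 \<le> s \<and> 0 \<le> t \<and> s + t \<le> 1 \<longrightarrow> \<omega> (s + t) \<le> \<omega> s + \<omega> t)"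

definition cz_kernel ::
  "(real \<Rightarrow> real) \<Rightarrow> (real ^ 'n \<Rightarrow> real ^ 'n \<Rightarrow> 'k::real_normed_vector) \<Rightarrow> bool" where
  "cz_kernel \<omega> K \<longleftrightarrow>
     (\<exists>C. \<forall>x y. x \<noteq> y \<longrightarrow> norm (K x y) \<le> C / norm (x - y) ^ CARD('n)) \<and>
     (\<forall>x x' y. norm (x - y) > 2 * norm (x - x') \<longrightarrow>
        norm (K x y - K x' y) + norm (K y x - K y x')
          \<le> \<omega> (norm (x - x') / norm (x - y)) / norm (x - y) ^ CARD('n))"

definition nondegenerate_kernel ::
  "(real \<Rightarrow> real) \<Rightarrow> (real ^ 'n \<Rightarrow> real ^ 'n \<Rightarrow> 'k::real_normed_vector) \<Rightarrow> bool" where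
  "nondegenerate_kernel \<omega> K \<longleftrightarrow> (\<omega> \<longlongrightarrow> 0) (at_right 0) \<and>
     (\<exists>c0>0. \<forall>y. \<forall>r>0. \<exists>x. x \<notin> ball y r \<and> norm (K x y) \<ge> c0 / r ^ CARD('n))"

definition L2 :: "(real ^ 'n \<Rightarrow> 'k::real_normed_vector) set" where
  "L2 = {f \<in> borel_measurable lebesgue. lp_norm 2 (\<lambda>_. 1) f < \<infinity>}"

text \<open>Elements of \<open>L2\<close> are represented by functions, so identities involving \<open>T f\<close> are
  required almost everywhere. Boundedness and linearity force \<open>T\<close> to respect a.e. equality
  on \<open>L2\<close>; the values of \<open>T\<close> outside \<open>L2\<close> are unconstrained.\<close>
definition cz_operator ::
  "(real \<Rightarrow> real) \<Rightarrow> (real ^ 'n \<Rightarrow> real ^ 'n \<Rightarrow> 'k) \<Rightarrow>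
   ((real ^ 'n \<Rightarrow> 'k) \<Rightarrow> real ^ 'n \<Rightarrow> 'k::{real_normed_field, banach, second_countable_topology}) \<Rightarrow> bool"
  where
  "cz_operator \<omega> K T \<longleftrightarrow>
     modulus_of_continuity \<omega> \<and> cz_kernel \<omega> K \<and>
     (\<forall>f\<in>L2. T f \<in> L2) \<and>
     (\<forall>c. \<forall>f\<in>L2. \<forall>g\<in>L2. AE x in lebesgue. T (\<lambda>y. c * f y + g y) x = c * T f x + T g x) \<and>
     (\<exists>C::real. \<forall>f\<in>L2. lp_norm 2 (\<lambda>_. 1) (T f) \<le> ennreal C * lp_norm 2 (\<lambda>_. 1) f) \<and>
     (\<forall>f\<in>L2. AE x in lebesgue. x \<notin> closure {y. f y \<noteq> 0} \<longrightarrow>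
        T f x = (LINT y|lebesgue. K x y * f y))"

definition nondegenerate_cz_operator ::
  "((real ^ 'n \<Rightarrow> 'k) \<Rightarrow> real ^ 'n \<Rightarrow> 'k::{real_normed_field, banach, second_countable_topology}) \<Rightarrow> bool"
  where
  "nondegenerate_cz_operator T \<longleftrightarrow>
     (\<exists>\<omega> K. cz_operator \<omega> K T \<and> nondegenerate_kernel \<omega> K \<and> nondegenerate_kernel \<omega> (\<lambda>x y. K y x))"

definition commutator ::
  "(real ^ 'n \<Rightarrow> real) \<Rightarrow> ((real ^ 'n \<Rightarrow> 'k) \<Rightarrow> real ^ 'n \<Rightarrow> 'k) \<Rightarrow>
   (real ^ 'n \<Rightarrow> 'k) \<Rightarrow> real ^ 'n \<Rightarrow> 'k::real_normed_field" where
  "commutator b S f = (\<lambda>x. of_real (b x) * S f x - S (\<lambda>y. of_real (b y) * f y) x)"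

text \<open>\<open>T\<^sub>b\<^sup>m\<close>. For bounded compactly supported \<open>f\<close> and \<open>b \<in> BMO\<close> it applies \<open>T\<close> only to the
  functions \<open>b\<^sup>k f\<close> with \<open>k \<le> m\<close>, which belong to \<open>L2\<close> by the John--Nirenberg inequality.\<close>
definition iter_commutator ::
  "((real ^ 'n \<Rightarrow> 'k) \<Rightarrow> real ^ 'n \<Rightarrow> 'k) \<Rightarrow> (real ^ 'n \<Rightarrow> real) \<Rightarrow> nat \<Rightarrow>
   (real ^ 'n \<Rightarrow> 'k) \<Rightarrow> real ^ 'n \<Rightarrow> 'k::real_normed_field" where
  "iter_commutator T b m = (commutator b ^^ m) T"

definition bounded_compactly_supported :: "(real ^ 'n \<Rightarrow> 'k::real_normed_vector) set" where
  "bounded_compactly_supported =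
     {f \<in> borel_measurable lebesgue. bounded (range f) \<and> compact (closure {x. f x \<noteq> 0})}"

end

(*
  A cube Q is tested against a cube P at distance comparable to its size on which the kernel is
  almost constant and bounded below by c / |Q|.  If b vanishes on P, then on P the commutator
  T_b^m f equals T (b^m f) up to sign, so for f >= 0 supported in Q it is at least a multiple of
  the mean of b^m f over Q.  With f = b^(m (p' - 1)) s, where s is a bounded approximation of
  v^(1 - p'), and with doubling to pass from u(P) to u(Q), the weak type estimate becomes
    (u_Q)^(1/p) ((b^(m p') s)_Q)^(1/p') <= C.
  The logarithmic bump comes from the choice b = log^+ of the Hardy-Littlewood maximal function of
  s restricted to Q, normalised so that b >= 1 on Q and b = 0 on P: its BMO norm depends only
  on the dimension (Coifman-Rochberg), and it dominates log (s / s_Q) almost everywhere on Q.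
*)
theory Submission
  imports Defs
begin

section \<open>The maximal function\<close>

text \<open>The natural test function v^(1 - p') may be infinite or fail to be locally integrable,
  so it is replaced by bounded functions s; all constants must then be independent of the bound on
  s. The power b^(m (p' - 1)) is the Hoelder extremiser: it makes the integral of f^p v at most that
  of b^m f. The same quantity then stands on both sides, and dividing by its power 1/p, which is
  legitimate because it is positive and finite, leaves the power 1/p'. Weak type costs only a factor
  2, because the lower bound on P is a constant. Nondegeneracy only places a good point outside a
  given ball; the size bound of the kernel is what keeps P from escaping, and so lets doubling
  compare u(P) with u(Q). The Luxemburg norm with parameter l involves log (s / l^p'), while b
  controls log (s / s_Q). The link is the testing inequality itself: as b >= 1 on Q, it bounds s_Q
  by K^p', where K = E (|Q| / u(Q))^(1/p). Hence s / K^p' is at most a multiple of exp b, and one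
  choice of b serves both the power and the logarithm.\<close>

definition maximal :: "('a::euclidean_space \<Rightarrow> ennreal) \<Rightarrow> 'a \<Rightarrow> ennreal" where
  "maximal g x = (SUP r\<in>{0<..}. (\<integral>\<^sup>+ y \<in> cball x r. g y \<partial>lebesgue) / ennreal (r ^ DIM('a)))"

lemma emeasure_lebesgue_cball:
  fixes c :: "'a::euclidean_space"
  assumes "0 \<le> r"
  shows "emeasure lebesgue (cball c r) = ennreal (unit_ball_vol DIM('a) * r ^ DIM('a))"
  using assms by (simp add: emeasure_cball)

text \<open>Clearing the denominator is safe even for an infinite integral. \<open>maximal\<close>
  divides by \<open>r ^ n\<close> instead of the volume of the ball, which is why
  \<open>unit_ball_vol\<close> appears in the later constants.\<close>

lemma less_maximal_iff:
  fixes g :: "'a::euclidean_space \<Rightarrow> ennreal"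
  assumes "0 \<le> s"
  shows "ennreal s < maximal g x \<longleftrightarrow>
    (\<exists>r>0. ennreal (s * r ^ DIM('a)) < (\<integral>\<^sup>+ y \<in> cball x r. g y \<partial>lebesgue))"
proof -
  have "ennreal s < a / ennreal (r ^ DIM('a)) \<longleftrightarrow> ennreal (s * r ^ DIM('a)) < a"
    if "r > 0" for r a
  proof (cases a)
    case (real t)
    then show ?thesis using that assms
      by (simp add: divide_ennreal ennreal_less_iff field_simps)
  next
    case top
    then show ?thesis by (simp add: ennreal_top_divide)
  qed
  then show ?thesis
    unfolding maximal_def less_SUP_iff by (auto simp: Bex_def)
qed

lemma maximal_le_iff:
  fixes g :: "'a::euclidean_space \<Rightarrow> ennreal"
  assumes "0 \<le> s"
  shows "maximal g x \<le> ennreal s \<longleftrightarrow>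
    (\<forall>r>0. (\<integral>\<^sup>+ y \<in> cball x r. g y \<partial>lebesgue) \<le> ennreal (s * r ^ DIM('a)))"
  using less_maximal_iff[OF assms, of g x] by (meson not_le)

lemma set_nn_integral_mono_set:
  "A \<subseteq> B \<Longrightarrow> (\<integral>\<^sup>+ y \<in> A. g y \<partial>M) \<le> (\<integral>\<^sup>+ y \<in> B. g y \<partial>M)"
  by (intro nn_integral_mono) (auto split: split_indicator)

text \<open>The strict inequality for a radius \<open>r\<close> survives with a slightly larger
  \<open>t\<close> in place of \<open>r\<close> on its left side, and the ball of radius
  \<open>t\<close> about any point within \<open>t - r\<close> of \<open>x\<close> contains the
  original ball. So \<open>maximal g\<close> is lower semicontinuous, hence Borel.\<close>

lemma open_less_maximal:
  fixes g :: "'a::euclidean_space \<Rightarrow> ennreal"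
  assumes "0 \<le> s"
  shows "open {x. ennreal s < maximal g x}"
  unfolding open_dist
proof
  fix x assume "x \<in> {x. ennreal s < maximal g x}"
  then obtain r where r: "r > 0" "ennreal (s * r ^ DIM('a)) < (\<integral>\<^sup>+ y \<in> cball x r. g y \<partial>lebesgue)"
    using less_maximal_iff[OF assms] by auto
  have "((\<lambda>t. ennreal (s * t ^ DIM('a))) \<longlongrightarrow> ennreal (s * r ^ DIM('a))) (at_right r)"
    by (intro tendsto_intros)
  then have "eventually (\<lambda>t. ennreal (s * t ^ DIM('a)) < (\<integral>\<^sup>+ y \<in> cball x r. g y \<partial>lebesgue)) (at_right r)"
    using r(2) by (rule order_tendstoD)
  then obtain b where b: "b > r"
    "\<And>t. r < t \<Longrightarrow> t < b \<Longrightarrow> ennreal (s * t ^ DIM('a)) < (\<integral>\<^sup>+ y \<in> cball x r. g y \<partial>lebesgue)"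
    by (auto simp: eventually_at_right_field)
  define t where "t = (r + b) / 2"
  have t: "r < t" "t < b" using b(1) by (auto simp: t_def)
  show "\<exists>e>0. \<forall>y. dist y x < e \<longrightarrow> y \<in> {x. ennreal s < maximal g x}"
  proof (intro exI[of _ "t - r"] conjI allI impI)
    fix y assume "dist y x < t - r"
    then have "cball x r \<subseteq> cball y t"
      by (smt (verit) dist_commute dist_triangle mem_cball subsetI)
    then have "ennreal (s * t ^ DIM('a)) < (\<integral>\<^sup>+ z \<in> cball y t. g z \<partial>lebesgue)"
      using b(2)[OF t] set_nn_integral_mono_set[of "cball x r" "cball y t" lebesgue g] by (meson less_le_trans)
    then show "y \<in> {x. ennreal s < maximal g x}"
      using less_maximal_iff[OF assms, of g y] r(1) t(1) by (auto intro!: exI[of _ t])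
  qed (use t in auto)
qed

lemma borel_measurable_maximal [measurable]:
  fixes g :: "'a::euclidean_space \<Rightarrow> ennreal"
  shows "maximal g \<in> borel_measurable borel"
proof (rule borel_measurableI_greater)
  fix y :: ennreal
  show "{x \<in> space borel. y < maximal g x} \<in> sets borel"
    using open_less_maximal[of "enn2real y" g] by (cases y) auto
qed

section \<open>The weak type inequality and the pointwise lower bound by Vitali coverings\<close>

lemma emeasure_UN_le_of_finite:
  assumes "countable C" "\<And>i. i \<in> C \<Longrightarrow> A i \<in> sets M"
    and "\<And>F. finite F \<Longrightarrow> F \<subseteq> C \<Longrightarrow> emeasure M (\<Union>i\<in>F. A i) \<le> c"
  shows "emeasure M (\<Union>i\<in>C. A i) \<le> c"
proof (cases "C = {}")
  case False
  define B where "B n = (\<Union>i\<in>from_nat_into C ` {..n}. A i)" for n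
  have sub: "from_nat_into C ` {..n} \<subseteq> C" for n
    using from_nat_into[OF False] by auto
  have "(\<Union>i\<in>C. A i) = (\<Union>n. B n)"
    using range_from_nat_into[OF False assms(1)] unfolding B_def by auto (metis atMost_iff image_iff order_refl)
  also have "emeasure M \<dots> = (SUP n. emeasure M (B n))"
  proof (rule SUP_emeasure_incseq[symmetric])
    show "range B \<subseteq> sets M"
      unfolding B_def using assms(2) sub by (auto intro!: sets.finite_UN)
    show "incseq B"
      unfolding B_def by (rule monoI) fastforce
  qed
  also have "\<dots> \<le> c"
    unfolding B_def by (intro SUP_least assms(3) sub) auto
  finally show ?thesis .
qed simp

text \<open>Each point of the level set carries a ball whose \<open>g\<close>-mass controls its
  volume. Vitali selects disjoint balls whose fivefold dilates still cover, which gives the factor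
  \<open>5 ^ n\<close>.\<close>

theorem maximal_weak_type:
  fixes g :: "'a::euclidean_space \<Rightarrow> ennreal"
  assumes [measurable]: "g \<in> borel_measurable lebesgue" and s: "s > 0"
  shows "emeasure lebesgue {x. ennreal s < maximal g x}
    \<le> ennreal (5 ^ DIM('a) * unit_ball_vol DIM('a) / s) * (\<integral>\<^sup>+ y. g y \<partial>lebesgue)"
proof (cases "\<integral>\<^sup>+ y. g y \<partial>lebesgue")
  case top
  moreover have "0 < 5 ^ DIM('a) * unit_ball_vol DIM('a) / s" using s by simp
  ultimately show ?thesis by (simp add: ennreal_mult_top ennreal_eq_0_iff not_le[symmetric] del: zero_less_divide_iff)
next
  case (real J)
  define S where "S = {x. ennreal s < maximal g x}"
  have "\<exists>r. x \<in> S \<longrightarrow> r > 0 \<and> ennreal (s * r ^ DIM('a)) < (\<integral>\<^sup>+ y \<in> cball x r. g y \<partial>lebesgue)" for x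
    using less_maximal_iff[of s g x] s by (auto simp: S_def)
  then obtain r where r: "\<And>x. x \<in> S \<Longrightarrow> r x > 0"
    "\<And>x. x \<in> S \<Longrightarrow> ennreal (s * r x ^ DIM('a)) < (\<integral>\<^sup>+ y \<in> cball x (r x). g y \<partial>lebesgue)"
    by metis
  \<comment> \<open>The Vitali lemma wants bounded radii. For a radius above 1 the mass condition
    gives \<open>s * r \<le> s * r ^ n < J\<close>.\<close>
  have r_le: "r x \<le> max 1 (J / s)" if "x \<in> S" for x
  proof (cases "r x \<le> 1")
    case False
    have "(\<integral>\<^sup>+ y \<in> cball x (r x). g y \<partial>lebesgue) \<le> (\<integral>\<^sup>+ y. g y \<partial>lebesgue)"
      by (intro nn_integral_mono) (auto split: split_indicator)
    then have "ennreal (s * r x ^ DIM('a)) < ennreal J"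
      using r(2)[OF that] real by order
    then have "s * r x ^ DIM('a) < J"
      using s r(1)[OF that] by (simp add: ennreal_less_iff)
    moreover have "r x \<le> r x ^ DIM('a)"
      using False by (intro self_le_power) auto
    ultimately have "s * r x \<le> J"
      using s by (smt (verit) mult_left_mono)
    then show ?thesis using s by (simp add: field_simps max.coboundedI2)
  qed simp
  have "S \<subseteq> (\<Union>i\<in>S. cball i (r i))"
    using r(1) by force
  then obtain C where C: "countable C" "C \<subseteq> S"
    "pairwise (\<lambda>i j. disjnt (cball i (r i)) (cball j (r j))) C"
    "S \<subseteq> (\<Union>i\<in>C. cball i (5 * r i))"
    by (rule Vitali_covering_lemma_cballs[where B = "max 1 (J / s)"]) (use r r_le in auto)
  let ?W = "5 ^ DIM('a) * unit_ball_vol DIM('a) / s"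
  have "emeasure lebesgue S \<le> emeasure lebesgue (\<Union>i\<in>C. cball i (5 * r i))"
    using C by (intro emeasure_mono) (auto intro!: sets.countable_UN')
  also have "\<dots> \<le> ennreal ?W * (\<integral>\<^sup>+ y. g y \<partial>lebesgue)"
  proof (rule emeasure_UN_le_of_finite)
    fix F assume F: "finite F" "F \<subseteq> C"
    have "emeasure lebesgue (\<Union>i\<in>F. cball i (5 * r i)) \<le> (\<Sum>i\<in>F. emeasure lebesgue (cball i (5 * r i)))"
      using F by (intro emeasure_subadditive_finite) auto
    also have "\<dots> \<le> (\<Sum>i\<in>F. ennreal ?W * (\<integral>\<^sup>+ y \<in> cball i (r i). g y \<partial>lebesgue))"
    proof (rule sum_mono)
      fix i assume "i \<in> F"
      then have i: "i \<in> S" using F C by auto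
      have "emeasure lebesgue (cball i (5 * r i)) = ennreal (unit_ball_vol DIM('a) * (5 * r i) ^ DIM('a))"
        using r(1)[OF i] by (intro emeasure_lebesgue_cball) auto
      also have "\<dots> = ennreal ?W * ennreal (s * r i ^ DIM('a))"
        using s r(1)[OF i] by (subst ennreal_mult[symmetric]) (auto simp: power_mult_distrib)
      also have "\<dots> \<le> ennreal ?W * (\<integral>\<^sup>+ y \<in> cball i (r i). g y \<partial>lebesgue)"
        using r(2)[OF i] by (intro mult_left_mono) auto
      finally show "emeasure lebesgue (cball i (5 * r i)) \<le> \<dots>" .
    qed
    also have "\<dots> = ennreal ?W * (\<Sum>i\<in>F. (\<integral>\<^sup>+ y \<in> cball i (r i). g y \<partial>lebesgue))"
      by (simp add: sum_distrib_left)
    \<comment> \<open>Read as measures with density \<open>g\<close>, the integrals over the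
      disjoint balls add up to at most the total mass.\<close>
    also have "(\<Sum>i\<in>F. (\<integral>\<^sup>+ y \<in> cball i (r i). g y \<partial>lebesgue))
        = (\<Sum>i\<in>F. emeasure (density lebesgue g) (cball i (r i)))"
      by (simp add: emeasure_density)
    also have "\<dots> = emeasure (density lebesgue g) (\<Union>i\<in>F. cball i (r i))"
    proof (rule sum_emeasure)
      show "disjoint_family_on (\<lambda>i. cball i (r i)) F"
        using C(3) F(2) by (auto simp: disjoint_family_on_def pairwise_def disjnt_def)
    qed (use F in auto)
    also have "\<dots> \<le> emeasure (density lebesgue g) (space lebesgue)"
      by (rule emeasure_mono) auto
    also have "\<dots> = (\<integral>\<^sup>+ y. g y \<partial>lebesgue)"
      by (simp add: emeasure_density)
    finally show "emeasure lebesgue (\<Union>i\<in>F. cball i (5 * r i)) \<le> ennreal ?W * (\<integral>\<^sup>+ y. g y \<partial>lebesgue)"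
      by (meson mult_left_mono zero_le)
  qed (use C in auto)
  finally show ?thesis by (simp add: S_def)
qed

text \<open>Lebesgue differentiation would give the constant \<open>unit_ball_vol n\<close>. Giving
  up a factor 2 leaves a gap that a direct covering argument can exploit, for any measurable
  \<open>g\<close>, integrable or not.\<close>

lemma AE_le_maximal:
  fixes g :: "'a::euclidean_space \<Rightarrow> ennreal"
  assumes [measurable]: "g \<in> borel_measurable lebesgue"
  shows "AE x in lebesgue. ennreal (unit_ball_vol DIM('a) / 2) * g x \<le> maximal g x"
proof -
  define w where "w = unit_ball_vol DIM('a)"
  have w: "0 < w" by (simp add: w_def)
  \<comment> \<open>A point where the claim fails lies in some \<open>S q k\<close> with
    \<open>q\<close> rational and \<open>k\<close> natural, a countable family. The ball
    \<open>cball 0 k\<close> keeps the measure finite, so that m <= (m + e) / 2 can be solved for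
    m.\<close>
  define S where "S q k = {x. ennreal q < g x \<and> maximal g x < ennreal (w / 2 * q)} \<inter> cball 0 k" for q k :: real
  have [measurable]: "maximal g \<in> borel_measurable lebesgue"
    by (simp add: measurable_completion borel_measurable_maximal)
  have Smeas: "S q k \<in> sets lebesgue" for q k
  proof -
    have "{x \<in> space lebesgue. ennreal q < g x \<and> maximal g x < ennreal (w / 2 * q)} \<in> sets lebesgue"
      by measurable
    then show ?thesis unfolding S_def by (intro sets.Int) auto
  qed
  (* S fills at most half of each small ball centred in it; covering S by
     disjoint such balls inside an open set of almost the same measure forces measure 0. *)
  have Snull: "emeasure lebesgue (S q k) = 0" if q: "q > 0" for q k
  proof -
    have lm: "S q k \<in> lmeasurable"
      by (rule fmeasurableI2[OF lmeasurable_cball[of 0 k] _ Smeas]) (simp add: S_def)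
    have half: "emeasure lebesgue (S q k \<inter> cball x r) \<le> ennreal (1/2) * emeasure lebesgue (cball x r)"
      if "x \<in> S q k" "r > 0" for x r
    proof -
      have "ennreal q * emeasure lebesgue (S q k \<inter> cball x r) = (\<integral>\<^sup>+ y \<in> S q k \<inter> cball x r. ennreal q \<partial>lebesgue)"
        using Smeas[of q k] by (subst nn_integral_cmult_indicator) auto
      also have "\<dots> \<le> (\<integral>\<^sup>+ y \<in> cball x r. g y \<partial>lebesgue)"
        by (intro nn_integral_mono) (auto simp: S_def split: split_indicator)
      also have "\<dots> \<le> ennreal (w / 2 * q * r ^ DIM('a))"
        using maximal_le_iff[of "w / 2 * q" g x] that q w by (auto simp: S_def intro: less_imp_le)
      also have "\<dots> = ennreal q * (ennreal (1/2) * emeasure lebesgue (cball x r))"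
        using q that w by (simp add: emeasure_cball w_def ennreal_mult[symmetric] mult_ac del: ennreal_half)
      finally show ?thesis
        using q by (subst (asm) ennreal_mult_le_mult_iff) auto
    qed
    let ?m = "measure lebesgue (S q k)"
    have "?m \<le> 0 + e" if e: "e > 0" for e
    proof -
      obtain U where U: "open U" "S q k \<subseteq> U" "U - S q k \<in> lmeasurable" "emeasure lebesgue (U - S q k) < ennreal e"
        using sets_lebesgue_outer_open[OF Smeas e] by metis
      have Ule: "emeasure lebesgue U \<le> emeasure lebesgue (S q k) + ennreal e"
      proof -
        have "U = S q k \<union> (U - S q k)" using U by auto
        then have "emeasure lebesgue U \<le> emeasure lebesgue (S q k) + emeasure lebesgue (U - S q k)"
          using Smeas U by (metis emeasure_subadditive sets.Diff fmeasurableD)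
        then show ?thesis using U(4) by (meson add_left_mono less_imp_le order_trans)
      qed
      define K where "K = {(x, r). x \<in> S q k \<and> 0 < r \<and> cball x r \<subseteq> U}"
      have pos: "0 < snd i" if "i \<in> K" for i
        using that by (auto simp: K_def)
      have cov: "\<exists>i. i \<in> K \<and> x \<in> cball (fst i) (snd i) \<and> snd i < d"
        if x: "x \<in> S q k" and d: "0 < d" for x d
      proof -
        obtain e where "e > 0" "cball x e \<subseteq> U" using x U by (meson open_contains_cball subsetD)
        then have "(x, min e (d/2)) \<in> K" using x d by (auto simp: K_def)
        then show ?thesis
          using d \<open>e > 0\<close> by (intro exI[of _ "(x, min e (d/2))"]) auto
      qed
      obtain C where C: "countable C" "C \<subseteq> K"
        "pairwise (\<lambda>i j. disjnt (cball (fst i) (snd i)) (cball (fst j) (snd j))) C"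
        "negligible (S q k - (\<Union>i\<in>C. cball (fst i) (snd i)))"
        by (rule Vitali_covering_theorem_cballs[of K snd "S q k" fst, OF pos cov])
      define A where "A i = cball (fst i) (snd i :: real)" for i :: "'a \<times> real"
      have Ameas: "A i \<in> sets lebesgue" for i by (simp add: A_def)
      have disj: "disjoint_family_on A C"
        using C(3) by (auto simp: disjoint_family_on_def pairwise_def disjnt_def A_def)
      have "S q k \<subseteq> (\<Union>i\<in>C. S q k \<inter> A i) \<union> (S q k - (\<Union>i\<in>C. A i))" by auto
      moreover have "(\<Union>i\<in>C. S q k \<inter> A i) \<in> sets lebesgue"
        using C(1) Smeas by (intro sets.countable_UN') (auto simp: A_def)
      moreover have "S q k - (\<Union>i\<in>C. A i) \<in> null_sets lebesgue"
        using C(4) by (simp add: A_def negligible_iff_null_sets)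
      ultimately have "emeasure lebesgue (S q k) \<le> emeasure lebesgue (\<Union>i\<in>C. S q k \<inter> A i)"
        by (metis emeasure_Un_null_set emeasure_mono null_setsD2 sets.Un)
      also have "\<dots> = (\<integral>\<^sup>+ i. emeasure lebesgue (S q k \<inter> A i) \<partial>count_space C)"
      proof (rule emeasure_UN_countable)
        show "disjoint_family_on (\<lambda>i. S q k \<inter> A i) C"
          using disj unfolding disjoint_family_on_def by blast
      qed (use C(1) Smeas in \<open>auto simp: A_def\<close>)
      also have "\<dots> \<le> (\<integral>\<^sup>+ i. ennreal (1/2) * emeasure lebesgue (A i) \<partial>count_space C)"
      proof (rule nn_integral_mono)
        fix i assume "i \<in> space (count_space C)"
        then have "i \<in> K" using C(2) by auto
        then show "emeasure lebesgue (S q k \<inter> A i) \<le> ennreal (1/2) * emeasure lebesgue (A i)"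
          unfolding A_def K_def by (intro half) auto
      qed
      also have "\<dots> = ennreal (1/2) * (\<integral>\<^sup>+ i. emeasure lebesgue (A i) \<partial>count_space C)"
        by (rule nn_integral_cmult) simp
      also have "(\<integral>\<^sup>+ i. emeasure lebesgue (A i) \<partial>count_space C) = emeasure lebesgue (\<Union>i\<in>C. A i)"
        using C(1) disj by (intro emeasure_UN_countable[symmetric]) (simp_all add: Ameas)
      also have "\<dots> \<le> emeasure lebesgue U"
      proof (rule emeasure_mono)
        show "(\<Union>i\<in>C. A i) \<subseteq> U" using C(2) unfolding A_def K_def by force
      qed (use U in auto)
      also note Ule
      finally have "emeasure lebesgue (S q k) \<le> ennreal (1/2) * (emeasure lebesgue (S q k) + ennreal e)"
        by (meson mult_left_mono zero_le)
      then have "ennreal ?m \<le> ennreal (1/2) * (ennreal ?m + ennreal e)"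
        using lm by (simp add: emeasure_eq_measure2 del: ennreal_half)
      also have "\<dots> = ennreal (1/2 * (?m + e))"
        using e by (subst ennreal_plus[symmetric], simp, simp, subst ennreal_mult[symmetric]) auto
      finally show ?thesis using e by (subst (asm) ennreal_le_iff) auto
    qed
    then have "?m \<le> 0" by (rule field_le_epsilon)
    then show ?thesis using lm by (simp add: emeasure_eq_measure2 measure_le_0_iff)
  qed
  have good: "AE x in lebesgue. \<forall>i::nat. \<forall>q\<in>{q\<in>\<rat>. q > 0}. x \<notin> S q (real i)"
  proof (subst AE_all_countable, intro allI, subst AE_ball_countable)
    show "countable {q::real. q \<in> \<rat> \<and> q > 0}"
      by (rule countable_subset[OF _ countable_rat]) auto
    show "\<forall>q\<in>{q \<in> \<rat>. 0 < q}. AE x in lebesgue. x \<notin> S q (real i)" for i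
      using Snull Smeas by (auto intro!: AE_not_in null_setsI)
  qed
  show ?thesis
  proof (rule AE_mp[OF good AE_I2], intro impI, rule ccontr)
    fix x assume *: "\<forall>i::nat. \<forall>q\<in>{q\<in>\<rat>. q > 0}. x \<notin> S q (real i)"
    assume "\<not> ennreal (unit_ball_vol DIM('a) / 2) * g x \<le> maximal g x"
    then have lt: "maximal g x < ennreal (w / 2) * g x" by (simp add: w_def)
    then obtain M where M: "M \<ge> 0" "maximal g x = ennreal M"
      by (metis ennreal_cases top.not_eq_extremum order.strict_trans2 top_greatest)
    have "\<exists>t\<ge>0. ennreal t \<le> g x \<and> M < w / 2 * t"
    proof (cases "g x")
      case (real t)
      have "ennreal (w / 2 * t) = ennreal (w / 2) * ennreal t"
        using w real by (intro ennreal_mult) auto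
      then have "ennreal M < ennreal (w / 2 * t)" using lt M real by simp
      then show ?thesis using real M by (intro exI[of _ t]) (auto simp: ennreal_less_iff)
    next
      case top
      \<comment> \<open>Where \<open>g\<close> is infinite any large \<open>t\<close> serves; this
        one makes \<open>w / 2 * t\<close> equal to \<open>2 * (M + 1)\<close>.\<close>
      have "w / 2 * (4 * (M + 1) / w) = 2 * (M + 1)" using w by simp
      then have "M < w / 2 * (4 * (M + 1) / w)" using M by simp
      then show ?thesis using M w top by (intro exI[of _ "4 * (M + 1) / w"]) auto
    qed
    then obtain t where t: "t \<ge> 0" "ennreal t \<le> g x" "M < w / 2 * t" by auto
    have "2 * M / w < t" using t w by (simp add: field_simps)
    then obtain q where q: "q \<in> \<rat>" "2 * M / w < q" "q < t" using Rats_dense_in_real by blast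
    have "q > 0" using q(2) M(1) w by (smt (verit) divide_nonneg_pos)
    have "ennreal q < ennreal t" using q \<open>q > 0\<close> by (intro ennreal_lessI) auto
    then have "ennreal q < g x" using t by order
    moreover have "M < w / 2 * q" using q w by (simp add: field_simps)
    then have "ennreal M < ennreal (w / 2 * q)"
      using M by (simp add: ennreal_less_iff)
    moreover obtain i :: nat where "norm x \<le> real i" using real_arch_simple by blast
    ultimately have "x \<in> S q (real i)" using M by (simp add: S_def)
    then show False using * q \<open>q > 0\<close> by auto
  qed
qed

section \<open>Cubes and mean oscillation\<close>

lemma cube_borel [measurable, simp]: "cube a h \<in> sets borel"
proof -
  have "{x\<in>space borel. \<forall>i. a $ i \<le> x $ i \<and> x $ i < a $ i + h} \<in> sets borel"
    by measurable
  then show ?thesis by (simp add: cube_def)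
qed

lemma cube_lebesgue [measurable, simp]: "cube a h \<in> sets lebesgue"
  by simp

lemma emeasure_lborel_cube:
  fixes a :: "real ^ 'n"
  assumes "0 < h"
  shows "emeasure lborel (cube a h) = ennreal (h ^ CARD('n))"
proof (rule antisym)
  define c where "c = a + (\<chi> i. h)"
  have ac: "\<forall>i\<in>Basis. a \<bullet> i \<le> c \<bullet> i"
    using assms by (auto simp: c_def Basis_vec_def inner_axis)
  have vol: "(\<Prod>i\<in>Basis. (c - a) \<bullet> i) = h ^ CARD('n)"
  proof -
    have "(\<Prod>i\<in>(Basis :: (real^'n) set). (c - a) \<bullet> i) = (\<Prod>i\<in>(Basis :: (real^'n) set). h)"
      by (rule prod.cong) (auto simp: c_def Basis_vec_def inner_axis)
    then show ?thesis by simp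
  qed
  have "cube a h \<subseteq> cbox a c"
    by (auto simp: cube_def mem_box_cart c_def less_imp_le)
  then have "emeasure lborel (cube a h) \<le> emeasure lborel (cbox a c)"
    by (rule emeasure_mono) simp
  then show "emeasure lborel (cube a h) \<le> ennreal (h ^ CARD('n))"
    using ac vol by (simp add: emeasure_lborel_cbox)
  have "box a c \<subseteq> cube a h"
    by (auto simp: cube_def mem_box_cart c_def less_imp_le)
  then have "emeasure lborel (box a c) \<le> emeasure lborel (cube a h)"
    by (rule emeasure_mono) simp
  then show "ennreal (h ^ CARD('n)) \<le> emeasure lborel (cube a h)"
    using ac vol by (simp add: emeasure_lborel_box)
qed

lemma emeasure_cube:
  fixes a :: "real ^ 'n"
  assumes "0 < h"
  shows "emeasure lebesgue (cube a h) = ennreal (h ^ CARD('n))"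
  using emeasure_lborel_cube[OF assms] by simp

lemma measure_cube:
  fixes a :: "real ^ 'n"
  assumes "0 < h"
  shows "measure lborel (cube a h) = h ^ CARD('n)" "measure lebesgue (cube a h) = h ^ CARD('n)"
  using emeasure_lborel_cube[OF assms, of a] assms by (simp_all add: measure_def)

lemma cube_lmeasurable: "0 < h \<Longrightarrow> cube a h \<in> lmeasurable"
  by (simp add: fmeasurable_def emeasure_lborel_cube)

lemma corner_in_cube: "0 < h \<Longrightarrow> a \<in> cube a h"
  by (simp add: cube_def)

text \<open>The factor \<open>CARD('n)\<close> comes from the l1 norm. The length d = n h obtained
  here is the unit for all later separations and the source of the powers \<open>n ^ n\<close> in
  the constants.\<close>

lemma dist_cube_le:
  fixes a :: "real ^ 'n" and h :: real
  assumes "x \<in> cube a h" "y \<in> cube a h"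
  shows "dist x y \<le> CARD('n) * h"
proof -
  have "norm (x - y) \<le> (\<Sum>i\<in>UNIV. \<bar>(x - y) $ i\<bar>)"
    by (rule norm_le_l1_cart)
  also have "\<dots> \<le> (\<Sum>i\<in>(UNIV :: 'n set). h)"
    using assms by (intro sum_mono) (auto simp: cube_def abs_le_iff field_simps; (smt (verit)))
  finally show ?thesis by (simp add: dist_norm)
qed

lemma cube_subset_cball:
  fixes a :: "real ^ 'n" and h :: real
  assumes "x \<in> cube a h"
  shows "cube a h \<subseteq> cball x (CARD('n) * h)"
  using dist_cube_le[OF assms] by (auto simp: mem_cball)

lemma enn_avg_cube:
  fixes a :: "real ^ 'n"
  assumes "0 < h"
  shows "enn_avg g (cube a h) = (\<integral>\<^sup>+ x \<in> cube a h. g x \<partial>lebesgue) / ennreal (h ^ CARD('n))"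
  using assms by (simp add: enn_avg_def emeasure_lborel_cube)

lemma enn_avg_cube_le_iff:
  fixes a :: "real ^ 'n"
  assumes "0 < h" "0 \<le> B"
  shows "enn_avg g (cube a h) \<le> ennreal B \<longleftrightarrow>
    (\<integral>\<^sup>+ x \<in> cube a h. g x \<partial>lebesgue) \<le> ennreal (B * h ^ CARD('n))"
proof (cases "\<integral>\<^sup>+ x \<in> cube a h. g x \<partial>lebesgue")
  case (real t)
  then show ?thesis using assms
    by (simp add: enn_avg_cube divide_ennreal divide_le_eq)
next
  case top
  then show ?thesis using assms by (simp add: enn_avg_cube ennreal_top_divide top_unique)
qed

lemma locally_integrable_bounded:
  fixes b :: "real ^ 'n \<Rightarrow> real"
  assumes [measurable]: "b \<in> borel_measurable lebesgue" and B: "\<And>x. \<bar>b x\<bar> \<le> B"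
  shows "locally_integrable b"
  unfolding locally_integrable_def
proof (intro allI impI)
  fix S :: "(real ^ 'n) set" assume "compact S"
  then have S: "S \<in> lmeasurable" by (rule lmeasurable_compact)
  have *: "integrable lebesgue (\<lambda>x. indicator S x *\<^sub>R B :: real)"
    using S by (intro integrable_scaleR_left) (auto simp: fmeasurable_def)
  show "b absolutely_integrable_on S"
    unfolding set_integrable_def
  proof (rule Bochner_Integration.integrable_bound[OF *])
    show "AE x in lebesgue. norm (indicat_real S x *\<^sub>R b x) \<le> norm (indicat_real S x *\<^sub>R B)"
      by (rule AE_I2) (use B order_trans[OF B abs_ge_self] in \<open>auto simp: indicator_def\<close>)
  qed (use S in measurable)
qed

text \<open>The mean of \<open>b\<close> differs from \<open>c\<close> by at most the mean of
  \<open>\<bar>b - c\<bar>\<close>, so replacing a convenient constant by the true average at most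
  doubles the oscillation.\<close>

lemma enn_avg_oscillation_le:
  fixes b :: "real ^ 'n \<Rightarrow> real"
  assumes [measurable]: "b \<in> borel_measurable lebesgue"
    and h: "0 < h" and int: "set_integrable lebesgue (cube a h) b"
    and B: "0 \<le> B" "enn_avg (\<lambda>x. ennreal \<bar>b x - c\<bar>) (cube a h) \<le> ennreal B"
  shows "enn_avg (\<lambda>x. ennreal \<bar>b x - avg b (cube a h)\<bar>) (cube a h) \<le> ennreal (2 * B)"
proof -
  let ?Q = "cube a h" and ?v = "h ^ CARD('n)"
  have v: "?v > 0" using h by simp
  have intc: "set_integrable lebesgue ?Q (\<lambda>x. b x - c)"
    using int h cube_lmeasurable[OF h, of a]
    by (intro set_integral_diff) (auto simp: set_integrable_def fmeasurable_def)
  have eq: "(\<integral>\<^sup>+ x \<in> ?Q. ennreal \<bar>b x - c\<bar> \<partial>lebesgue) = ennreal (LINT x:?Q|lebesgue. \<bar>b x - c\<bar>)"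
    using set_integrable_abs[OF intc] by (subst nn_integral_set_ennreal)
      (auto simp: set_lebesgue_integral_def set_integrable_def nn_integral_eq_integral abs_mult mult.commute)
  then have le: "(LINT x:?Q|lebesgue. \<bar>b x - c\<bar>) \<le> B * ?v"
    using B(2) v B(1) unfolding enn_avg_cube_le_iff[OF h B(1)] eq by (subst (asm) ennreal_le_iff) auto
  have "\<bar>LINT x:?Q|lebesgue. b x - c\<bar> \<le> (LINT x:?Q|lebesgue. \<bar>b x - c\<bar>)"
    using set_integral_norm_bound[OF intc] by simp
  moreover have "(LINT x:?Q|lebesgue. b x - c) = (LINT x:?Q|lebesgue. b x) - c * ?v"
    using int cube_lmeasurable[OF h, of a] h
    by (subst set_integral_diff) (auto simp: set_integrable_def fmeasurable_def set_lebesgue_integral_def measure_cube)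
  ultimately have "\<bar>(LINT x:?Q|lebesgue. b x) - c * ?v\<bar> \<le> B * ?v"
    using le by linarith
  moreover have "(LINT x:?Q|lebesgue. b x) - c * ?v = (avg b ?Q - c) * ?v"
    using h by (simp add: avg_def measure_cube[OF h] left_diff_distrib)
  ultimately have "\<bar>avg b ?Q - c\<bar> \<le> B"
    using v by (simp add: abs_mult)
  then have "(\<integral>\<^sup>+ x \<in> ?Q. ennreal \<bar>b x - avg b ?Q\<bar> \<partial>lebesgue)
      \<le> (\<integral>\<^sup>+ x. ennreal \<bar>b x - c\<bar> * indicator ?Q x + ennreal B * indicator ?Q x \<partial>lebesgue)"
    using B by (intro nn_integral_mono) (auto split: split_indicator simp: ennreal_plus[symmetric] simp del: ennreal_plus)
  also have "\<dots> = (\<integral>\<^sup>+ x \<in> ?Q. ennreal \<bar>b x - c\<bar> \<partial>lebesgue) + ennreal B * emeasure lebesgue ?Q"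
    by (subst nn_integral_add) (simp_all add: nn_integral_cmult_indicator)
  also have "\<dots> \<le> ennreal (B * ?v) + ennreal (B * ?v)"
    using le eq B v h by (intro add_mono) (auto simp: emeasure_lborel_cube ennreal_mult[symmetric] intro: ennreal_leI)
  also have "\<dots> = ennreal (2 * B * ?v)"
    using B v by (simp add: ennreal_plus[symmetric] del: ennreal_plus)
  finally show ?thesis
    using enn_avg_cube_le_iff[OF h, of "2 * B" _ a] B by simp
qed

section \<open>The logarithm of the maximal function\<close>

text \<open>The sum counts the integers k >= 0 below \<open>ln y\<close>, a discrete layer cake
  formula. For \<open>y \<le> 1\<close> the left side is 0, because \<open>ennreal\<close> truncates
  negative reals.\<close>

lemma ln_le_suminf_indicator:
  fixes y :: real
  assumes "0 < y"
  shows "ennreal (ln y) \<le> (\<Sum>k. if exp (real k) < y then 1 else 0)"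
proof (cases "y \<le> 1")
  case True
  then have "ln y \<le> 0" using assms by simp
  then show ?thesis by (simp add: ennreal_neg)
next
  case False
  define K where "K = nat \<lceil>ln y\<rceil>"
  have "exp (real k) < y" if "k < K" for k
  proof -
    have "real k < ln y" using that False by (simp add: K_def) linarith
    then show ?thesis using assms by (metis exp_less_mono exp_ln)
  qed
  then have "(\<Sum>k<K. if exp (real k) < y then 1 else 0 :: ennreal) = of_nat K" by simp
  moreover have "ln y \<le> real K" unfolding K_def using False by linarith
  then have "ennreal (ln y) \<le> of_nat K" by (simp add: ennreal_of_nat_eq_real_of_nat)
  ultimately show ?thesis
    by (metis (no_types, lifting) sum_le_suminf order_trans summableI finite_lessThan zero_le)
qed


lemma borel_measurable_log_maximal [measurable]:
  "(\<lambda>x. ln (max (enn2real (maximal g x)) c / c)) \<in> borel_measurable lebesgue"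
proof -
  have [measurable]: "maximal g \<in> borel_measurable lebesgue"
    by (simp add: measurable_completion borel_measurable_maximal)
  show ?thesis by measurable
qed

text \<open>With \<open>l\<close> the infimum of \<open>M\<close> on the cube, the logarithm is
  nonnegative there. The weak type bound shows that the part of the cube where \<open>M\<close>
  exceeds a level s has measure O(l |Q| / s), so the levels growing like exp k contribute a
  geometric series. Cutting off below at \<open>c\<close> makes the infimum positive.\<close>

lemma maximal_oscillation:
  fixes g :: "real ^ 'n \<Rightarrow> ennreal"
  defines "w \<equiv> 5 ^ CARD('n) * unit_ball_vol CARD('n)"
  assumes [measurable]: "g \<in> borel_measurable lebesgue"
    and fin: "\<And>x. maximal g x < \<infinity>" and c: "0 < c" and h: "0 < h"
  defines "M \<equiv> \<lambda>x. max (enn2real (maximal g x)) c"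
  obtains l where "0 < l"
    "(\<integral>\<^sup>+ x \<in> cube a h. ennreal \<bar>ln (M x / l)\<bar> \<partial>lebesgue)
      \<le> ennreal ((ln (2 ^ (CARD('n) + 1)) + w * CARD('n) ^ CARD('n) / (1 - exp (- 1))) * h ^ CARD('n))"
proof -
  let ?n = "CARD('n)" and ?Q = "cube a h"
  define d where "d = ?n * h"
  have d: "0 < d" using h by (simp add: d_def)
  have [measurable]: "maximal g \<in> borel_measurable lebesgue"
    by (simp add: measurable_completion borel_measurable_maximal)
  have Mmeas [measurable]: "M \<in> borel_measurable lebesgue"
    unfolding M_def by measurable
  have Mc: "c \<le> M x" for x by (simp add: M_def)
  have w: "0 < w" by (simp add: w_def)
  let ?l = "Inf (M ` ?Q)"
  have bdd: "bdd_below (M ` ?Q)" using Mc by (intro bdd_belowI2)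
  have ne: "M ` ?Q \<noteq> {}" using corner_in_cube[OF h] by auto
  have lc: "c \<le> ?l" using ne Mc by (intro cINF_greatest) auto
  have lM: "?l \<le> M x" if "x \<in> ?Q" for x using bdd that by (rule cINF_lower)
  have less: "Inf (M ` ?Q) < 2 * ?l" using lc c by simp
  \<comment> \<open>The infimum need not be attained; a point within a factor 2 of it bounds the
    integrals of \<open>g\<close> over all balls centred there.\<close>
  obtain x0 where x0: "x0 \<in> ?Q" "M x0 < 2 * ?l"
    using cInf_lessD[OF ne less] by auto
  define l where "l = ?l"
  have l: "0 < l" "c \<le> l" "\<And>x. x \<in> ?Q \<Longrightarrow> l \<le> M x" "M x0 < 2 * l"
    using c lc lM x0 by (auto simp: l_def)
  have "maximal g x0 \<le> ennreal (2 * l)"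
    using l(4) fin[of x0] by (simp add: M_def enn2real_le less_imp_le) 
  then have ball: "(\<integral>\<^sup>+ y \<in> cball x0 r. g y \<partial>lebesgue) \<le> ennreal (2 * l * r ^ ?n)" if "r > 0" for r
    using maximal_le_iff[of "2 * l" g x0] l that by simp
  \<comment> \<open>A ball of radius at most \<open>d\<close> about a point of the cube lies in
    \<open>cball x0 (2 * d)\<close>, because that point is within \<open>d\<close> of
    \<open>x0\<close>.\<close>
  define g1 where "g1 y = g y * indicator (cball x0 (2 * d)) y" for y
  have [measurable]: "g1 \<in> borel_measurable lebesgue"
    unfolding g1_def by (intro borel_measurable_times_ennreal borel_measurable_indicator) auto
  have g1: "(\<integral>\<^sup>+ y. g1 y \<partial>lebesgue) \<le> ennreal (2 ^ (?n + 1) * l * d ^ ?n)"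
    using ball[of "2 * d"] d by (simp add: g1_def power_mult_distrib mult_ac)
  (* On balls of radius larger than d the means of g are at most 2^(n+1) l by comparison with
     balls centred at x0, so higher levels are only reached through g1. *)
  have level: "{x \<in> ?Q. s < M x} \<subseteq> {x. ennreal s < maximal g1 x}" if s: "2 ^ (?n + 1) * l \<le> s" for s
  proof safe
    fix x assume x: "x \<in> ?Q" "s < M x"
    have "1 * l \<le> 2 ^ (?n + 1) * l" using l by (intro mult_right_mono) (auto simp del: power_Suc)
    then have "c \<le> s" "0 < s" using s l(1,2) by linarith+
    then have "s < enn2real (maximal g x)" using x by (auto simp: M_def)
    then have "ennreal s < maximal g x"
      using \<open>0 < s\<close> fin[of x] by (metis enn2real_nonneg ennreal_enn2real ennreal_less_iff infinity_ennreal_def less_imp_le)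
    then obtain r where r: "r > 0" "ennreal (s * r ^ ?n) < (\<integral>\<^sup>+ y \<in> cball x r. g y \<partial>lebesgue)"
      using less_maximal_iff[of s g x] \<open>0 < s\<close> by auto
    have dx: "dist x0 x \<le> d" using dist_cube_le[OF x0(1) x(1)] by (simp add: d_def)
    have "r \<le> d"
    proof (rule ccontr)
      assume "\<not> r \<le> d"
      then have "cball x r \<subseteq> cball x0 (2 * r)"
        using dx by (simp add: cball_subset_cball_iff dist_commute)
      then have "(\<integral>\<^sup>+ y \<in> cball x r. g y \<partial>lebesgue) \<le> ennreal (2 * l * (2 * r) ^ ?n)"
        using r(1) by (intro order_trans[OF set_nn_integral_mono_set ball[of "2 * r"]]) auto
      moreover have "2 * l * (2 * r) ^ ?n \<le> s * r ^ ?n"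
        using mult_right_mono[OF s, of "r ^ ?n"] r(1) by (simp add: power_mult_distrib mult_ac)
      ultimately show False using r(2) by (meson ennreal_leI leD order_trans)
    qed
    then have "cball x r \<subseteq> cball x0 (2 * d)"
      using dx by (simp add: cball_subset_cball_iff dist_commute)
    then have "(\<integral>\<^sup>+ y \<in> cball x r. g y \<partial>lebesgue) = (\<integral>\<^sup>+ y \<in> cball x r. g1 y \<partial>lebesgue)"
      by (intro nn_integral_cong) (auto simp: g1_def split: split_indicator)
    then show "ennreal s < maximal g1 x"
      using r \<open>0 < s\<close> less_maximal_iff[of s g1 x] by auto
  qed
  \<comment> \<open>The levels start at the threshold from which \<open>level\<close> applies. The
    range below it accounts for the term \<open>ln (2 ^ (n + 1))\<close>.\<close>
  define s where "s k = 2 ^ (?n + 1) * l * exp (real k)" for k :: nat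
  have s: "0 < s k" "2 ^ (?n + 1) * l \<le> s k" for k
  proof -
    have "2 ^ (?n + 1) * l * 1 \<le> 2 ^ (?n + 1) * l * exp (real k)"
      using l(1) by (intro mult_left_mono) auto
    then show "2 ^ (?n + 1) * l \<le> s k" by (simp add: s_def)
    show "0 < s k" using l(1) by (simp add: s_def)
  qed
  have meas_level: "{x \<in> ?Q. s k < M x} \<in> sets lebesgue" for k
  proof -
    have "?Q \<inter> {x \<in> space lebesgue. s k < M x} \<in> sets lebesgue"
      by (intro sets.Int cube_lebesgue) measurable
    moreover have "?Q \<inter> {x \<in> space lebesgue. s k < M x} = {x \<in> ?Q. s k < M x}" by auto
    ultimately show ?thesis by simp
  qed
  have small: "emeasure lebesgue {x \<in> ?Q. s k < M x} \<le> ennreal (w * ?n ^ ?n * h ^ ?n * exp (- 1) ^ k)" for k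
  proof -
    have op: "{x. ennreal (s k) < maximal g1 x} \<in> sets lebesgue"
      using open_less_maximal[of "s k" g1] s(1)[of k] by (simp add: borel_open less_imp_le)
    have "emeasure lebesgue {x \<in> ?Q. s k < M x} \<le> emeasure lebesgue {x. ennreal (s k) < maximal g1 x}"
      by (rule emeasure_mono[OF level[OF s(2)] op])
    also have "\<dots> \<le> ennreal (w / s k) * (\<integral>\<^sup>+ y. g1 y \<partial>lebesgue)"
      using maximal_weak_type[of g1 "s k"] s(1)[of k] by (simp add: w_def)
    also have "\<dots> \<le> ennreal (w / s k) * ennreal (2 ^ (?n + 1) * l * d ^ ?n)"
      by (intro mult_left_mono g1) auto
    also have "\<dots> = ennreal (w / s k * (2 ^ (?n + 1) * l * d ^ ?n))"
      using w s(1)[of k] l d by (intro ennreal_mult[symmetric]) auto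
    also have "w / s k * (2 ^ (?n + 1) * l * d ^ ?n) = w * ?n ^ ?n * h ^ ?n * exp (- 1) ^ k"
    proof -
      have "exp (- 1 :: real) ^ k = 1 / exp (real k)"
        using exp_of_nat_mult[of k "- 1 :: real"] by (simp add: exp_minus inverse_eq_divide)
      then show ?thesis
        using l by (simp add: s_def d_def power_mult_distrib)
    qed
    finally show ?thesis .
  qed
  have pt: "ennreal \<bar>ln (M x / l)\<bar> * indicator ?Q x \<le>
      ennreal (ln (2 ^ (?n + 1))) * indicator ?Q x + (\<Sum>k. indicator {x \<in> ?Q. s k < M x} x)" for x
  proof (cases "x \<in> ?Q")
    case True
    have lx: "1 \<le> M x / l" using l True by simp
    then have pos: "0 < M x" using l by (simp add: zero_less_divide_iff)
    define y where "y = M x / (2 ^ (?n + 1) * l)"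
    have y: "0 < y" using l pos by (simp add: y_def)
    have "M x / l = 2 ^ (?n + 1) * y" using l by (simp add: y_def)
    moreover have "ln (2 ^ (?n + 1) * y) = ln (2 ^ (?n + 1)) + ln y"
      by (rule ln_mult_pos) (use y in auto)
    moreover have "0 \<le> ln (M x / l)" using lx by simp
    ultimately have "\<bar>ln (M x / l)\<bar> = ln (2 ^ (?n + 1)) + ln y" by simp
    moreover have "0 \<le> ln (2 ^ (?n + 1) :: real)" by (intro ln_ge_zero one_le_power) simp
    ultimately have "ennreal \<bar>ln (M x / l)\<bar> \<le> ennreal (ln (2 ^ (?n + 1))) + ennreal (ln y)"
      by (simp only: ennreal_plus_if) (auto intro: ennreal_leI)
    also have "ennreal (ln y) \<le> (\<Sum>k. if exp (real k) < y then 1 else 0)"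
      by (rule ln_le_suminf_indicator[OF y])
    also have "\<dots> = (\<Sum>k. indicator {x \<in> ?Q. s k < M x} x)"
    proof (rule suminf_cong)
      fix k
      have "exp (real k) < y \<longleftrightarrow> s k < M x"
        using l by (simp add: s_def y_def less_divide_eq mult_ac)
      then show "(if exp (real k) < y then 1 else 0 :: ennreal) = indicator {x \<in> ?Q. s k < M x} x"
        using True by simp
    qed
    finally show ?thesis using True by simp
  qed simp
  have "(\<integral>\<^sup>+ x \<in> ?Q. ennreal \<bar>ln (M x / l)\<bar> \<partial>lebesgue) \<le>
     (\<integral>\<^sup>+ x. ennreal (ln (2 ^ (?n + 1))) * indicator ?Q x + (\<Sum>k. indicator {x \<in> ?Q. s k < M x} x) \<partial>lebesgue)"
    by (intro nn_integral_mono pt)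
  also have "\<dots> = ennreal (ln (2 ^ (?n + 1))) * emeasure lebesgue ?Q
      + (\<Sum>k. emeasure lebesgue {x \<in> ?Q. s k < M x})"
    using meas_level
    by (subst nn_integral_add)
       (auto simp: nn_integral_cmult_indicator nn_integral_suminf intro!: borel_measurable_suminf borel_measurable_indicator)
  also have "\<dots> \<le> ennreal (ln (2 ^ (?n + 1))) * ennreal (h ^ ?n)
      + (\<Sum>k. ennreal (w * ?n ^ ?n * h ^ ?n * exp (- 1) ^ k))"
    using h by (intro add_mono suminf_le small) (auto simp: emeasure_lborel_cube)
  also have "(\<Sum>k. ennreal (w * ?n ^ ?n * h ^ ?n * exp (- 1) ^ k))
      = ennreal (w * ?n ^ ?n * h ^ ?n * (1 / (1 - exp (- 1))))"
    using w h by (intro suminf_ennreal_eq sums_mult geometric_sums) auto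
  also have "ennreal (ln (2 ^ (?n + 1))) * ennreal (h ^ ?n) + \<dots> =
      ennreal ((ln (2 ^ (?n + 1)) + w * ?n ^ ?n / (1 - exp (- 1))) * h ^ ?n)"
  proof -
    have *: "ennreal A * ennreal v + ennreal D = ennreal E"
      if "0 \<le> A" "0 \<le> v" "0 \<le> D" "E = A * v + D" for A v D E
      using that by (simp add: ennreal_mult)
    show ?thesis
      using w h by (intro *) (auto simp: distrib_right simp del: power_Suc intro!: ln_ge_zero one_le_power)
  qed
  finally show thesis using that l(1) by blast
qed


text \<open>Twice the bound of \<open>maximal_oscillation\<close>, the 2 being the price of passing
  to the true mean: the first summand is the height of the lowest level, the second the sum of the
  geometric series above it.\<close>

definition bmo_const :: "nat \<Rightarrow> real" where
  "bmo_const n = 2 * (ln (2 ^ (n + 1)) + 5 ^ n * unit_ball_vol n * n ^ n / (1 - exp (- 1)))"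

lemma bmo_const_nonneg: "0 \<le> bmo_const n"
  unfolding bmo_const_def
  by (intro mult_nonneg_nonneg add_nonneg_nonneg divide_nonneg_nonneg ln_ge_zero one_le_power) auto

text \<open>Dividing by \<open>c\<close> instead of by the infimum on a given cube changes the
  logarithm only by a constant, which the mean oscillation does not see. The bound \<open>B\<close>
  yields local integrability and leaves no trace in the BMO norm.\<close>

theorem log_maximal_BMO:
  fixes g :: "real ^ 'n \<Rightarrow> ennreal"
  assumes [measurable]: "g \<in> borel_measurable lebesgue"
    and bound: "\<And>x. maximal g x \<le> ennreal B" and c: "0 < c"
  defines "b \<equiv> \<lambda>x. ln (max (enn2real (maximal g x)) c / c)"
  shows "b \<in> BMO" and "bmo_norm b \<le> ennreal (bmo_const CARD('n))"
proof -
  let ?N = "ln (2 ^ (CARD('n) + 1)) + 5 ^ CARD('n) * unit_ball_vol CARD('n) * CARD('n) ^ CARD('n) / (1 - exp (- 1))"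
  have [measurable]: "b \<in> borel_measurable lebesgue"
    unfolding b_def by (rule borel_measurable_log_maximal)
  have fin: "maximal g x < \<infinity>" for x
    using bound[of x] by (metis ennreal_less_top infinity_ennreal_def order.strict_trans1)
  have "\<bar>b x\<bar> \<le> ln (max B c / c)" for x
  proof -
    have "enn2real (maximal g x) \<le> max B c"
      using bound[of x] c by (intro enn2real_leI) (auto simp: max_def intro: order_trans ennreal_leI)
    then have "1 \<le> max (enn2real (maximal g x)) c / c" "max (enn2real (maximal g x)) c / c \<le> max B c / c"
      using c by (auto simp: field_simps)
    then show ?thesis unfolding b_def by simp
  qed
  then have loc: "locally_integrable b"
    by (intro locally_integrable_bounded) auto
  have osc: "enn_avg (\<lambda>x. ennreal \<bar>b x - avg b Q\<bar>) Q \<le> ennreal (bmo_const CARD('n))"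
    if "Q \<in> cubes" for Q
  proof -
    obtain a h where Q: "Q = cube a h" "0 < h" using \<open>Q \<in> cubes\<close> by (auto simp: cubes_def)
    obtain l where l: "0 < l"
      "(\<integral>\<^sup>+ x \<in> Q. ennreal \<bar>ln (max (enn2real (maximal g x)) c / l)\<bar> \<partial>lebesgue) \<le> ennreal (?N * h ^ CARD('n))"
      using maximal_oscillation[of g, OF _ fin c Q(2)] Q(1) by auto
    have N: "0 \<le> ?N"
      by (intro add_nonneg_nonneg mult_nonneg_nonneg divide_nonneg_nonneg ln_ge_zero one_le_power) auto
    have "b x - ln (l / c) = ln (max (enn2real (maximal g x)) c / l)" for x
    proof -
      have "max (enn2real (maximal g x)) c \<noteq> 0" using c by auto
      then show ?thesis using c l(1) by (simp add: b_def ln_div)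
    qed
    then have "enn_avg (\<lambda>x. ennreal \<bar>b x - ln (l / c)\<bar>) Q \<le> ennreal ?N"
      using l(2) enn_avg_cube_le_iff[OF Q(2) N, of _ a] Q(1) by simp
    moreover have "set_integrable lebesgue Q b"
    proof (rule set_integrable_subset)
      show "set_integrable lebesgue (cball a (CARD('n) * h)) b"
        using loc unfolding locally_integrable_def by simp
      show "Q \<subseteq> cball a (CARD('n) * h)"
        using cube_subset_cball[OF corner_in_cube] Q by auto
    qed (use Q in auto)
    ultimately show ?thesis
      using enn_avg_oscillation_le[of b h a ?N] Q N by (simp add: bmo_const_def)
  qed
  then show norm: "bmo_norm b \<le> ennreal (bmo_const CARD('n))"
    unfolding bmo_norm_def by (intro SUP_least)
  then show "b \<in> BMO"
    using loc by (simp add: BMO_def) (metis ennreal_less_top infinity_ennreal_def order.strict_trans1)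
qed

text \<open>The upper bound \<open>G\<close> makes \<open>b\<close> bounded, but only the existence
  of \<open>B\<close> depends on it. The constants in the BMO norm, in the separation and in the
  exponential estimate are independent of \<open>G\<close>.\<close>

theorem log_maximal_test_function:
  fixes g :: "real ^ 'n \<Rightarrow> real" and h G J :: real
  assumes [measurable]: "g \<in> borel_measurable lebesgue"
    and g: "\<And>x. 0 \<le> g x" "\<And>x. g x \<le> G" "\<And>x. x \<notin> cube a h \<Longrightarrow> g x = 0"
    and h: "0 < h" and J: "(\<integral>\<^sup>+ x. ennreal (g x) \<partial>lebesgue) = ennreal J" "0 < J"
  obtains b B where "b \<in> BMO" "bmo_norm b \<le> ennreal (bmo_const CARD('n))"
    "b \<in> borel_measurable lebesgue" "\<And>x. 0 \<le> b x" "\<And>x. b x \<le> B"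
    "\<And>x. x \<in> cube a h \<Longrightarrow> 1 \<le> b x" "\<And>x. 4 * (CARD('n) * h) \<le> dist a x \<Longrightarrow> b x = 0"
    "AE x in lebesgue. unit_ball_vol CARD('n) / 2 * CARD('n) ^ CARD('n) * h ^ CARD('n) * g x \<le> J * exp (b x)"
proof -
  let ?n = "CARD('n)"
  define d where "d = ?n * h"
  have d: "0 < d" using h by (simp add: d_def)
  define gE where "gE y = ennreal (g y)" for y
  have [measurable]: "gE \<in> borel_measurable lebesgue" unfolding gE_def by measurable
  have supp: "gE y = 0" if "y \<notin> cube a h" for y using g(3)[OF that] by (simp add: gE_def)
  define w where "w = unit_ball_vol ?n"
  have w: "0 < w" by (simp add: w_def)
  have G: "0 \<le> G" using g(1,2) order_trans by blast
  have bound: "maximal gE x \<le> ennreal (G * w)" for x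
  proof (subst maximal_le_iff, use G w in simp, intro allI impI)
    fix r :: real assume r: "0 < r"
    have "(\<integral>\<^sup>+ y \<in> cball x r. gE y \<partial>lebesgue) \<le> (\<integral>\<^sup>+ y \<in> cball x r. ennreal G \<partial>lebesgue)"
      using g(2) by (intro nn_integral_mono) (auto simp: gE_def intro!: ennreal_leI split: split_indicator)
    also have "\<dots> = ennreal G * emeasure lebesgue (cball x r)"
      by (subst nn_integral_cmult_indicator) auto
    also have "\<dots> = ennreal (G * w * r ^ DIM(real ^ 'n))"
      using r G w by (simp add: emeasure_cball w_def ennreal_mult mult_ac)
    finally show "(\<integral>\<^sup>+ y \<in> cball x r. gE y \<partial>lebesgue) \<le> ennreal (G * w * r ^ DIM(real ^ 'n))" .
  qed
  have fin: "maximal gE x < top" for x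
    using bound[of x] by (metis ennreal_less_top order.strict_trans1)
  define m where "m x = enn2real (maximal gE x)" for x
  have m: "maximal gE x = ennreal (m x)" for x
    using fin[of x] by (simp add: m_def)
  \<comment> \<open>Seen from a point of the cube, the ball of radius \<open>d\<close> catches all
    the mass, so the maximal function is at least \<open>J / d ^ n\<close>, which is
    \<open>exp 1 * c\<close>; hence b >= 1 there. From distance \<open>4 * d\<close> only radii of
    at least \<open>3 * d\<close> meet the cube, and exp 1 <= 3 <= 3 ^ n makes their contribution at
    most \<open>c\<close>; hence b = 0.\<close>
  define c where "c = J / (exp 1 * d ^ ?n)"
  have c: "0 < c" using J d by (simp add: c_def)
  define b where "b x = ln (max (m x) c / c)" for x
  have b_eq: "b = (\<lambda>x. ln (max (enn2real (maximal gE x)) c / c))"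
    by (simp add: b_def m_def fun_eq_iff)
  have exp_b: "exp (b x) = max (m x) c / c" for x
    using c by (simp add: b_def max_def)
  have "b \<in> BMO" "bmo_norm b \<le> ennreal (bmo_const ?n)"
    unfolding b_eq by (rule log_maximal_BMO[OF _ bound c]; measurable)+
  moreover have "b \<in> borel_measurable lebesgue"
    unfolding b_eq by (rule borel_measurable_log_maximal)
  moreover have "0 \<le> b x" for x
  proof -
    have "1 \<le> exp (b x)" unfolding exp_b using c by simp
    then show ?thesis by simp
  qed
  moreover have "b x \<le> ln (max (G * w) c / c)" for x
  proof -
    have "m x \<le> G * w"
      using bound[of x] G w by (simp add: m)
    then have "max (m x) c / c \<le> max (G * w) c / c" "0 < max (m x) c / c"
      using c by (auto intro!: divide_right_mono)
    then show ?thesis unfolding b_def by (intro ln_mono) auto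
  qed
  moreover have "1 \<le> b x" if x: "x \<in> cube a h" for x
  proof -
    have "ennreal J / ennreal (d ^ DIM(real ^ 'n)) \<le> maximal gE x"
    proof -
      have "cube a h \<subseteq> cball x d"
        using cube_subset_cball[OF x] by (simp add: d_def)
      then have "(\<integral>\<^sup>+ y \<in> cball x d. gE y \<partial>lebesgue) = (\<integral>\<^sup>+ y. gE y \<partial>lebesgue)"
        using supp by (intro nn_integral_cong) (auto simp del: mem_cball split: split_indicator)
      then have "ennreal J = (\<integral>\<^sup>+ y \<in> cball x d. gE y \<partial>lebesgue)"
        using J by (simp add: gE_def)
      then show ?thesis unfolding maximal_def
        using d by (intro SUP_upper2[of d]) auto
    qed
    then have "ennreal (J / d ^ ?n) \<le> ennreal (m x)"
      using J d by (simp add: m divide_ennreal)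
    then have "J / d ^ ?n \<le> m x" by (simp add: m_def)
    moreover have "J / d ^ ?n = exp 1 * c" by (simp add: c_def)
    ultimately have "exp 1 \<le> max (m x) c / c"
      using c by (simp add: le_divide_eq)
    then show ?thesis using exp_b[of x] exp_le_cancel_iff by metis
  qed
  moreover have "b x = 0" if x: "4 * (?n * h) \<le> dist a x" for x
  proof -
    have "maximal gE x \<le> ennreal c"
    proof (subst maximal_le_iff, use c in simp, intro allI impI)
      fix r :: real assume r: "0 < r"
      show "(\<integral>\<^sup>+ y \<in> cball x r. gE y \<partial>lebesgue) \<le> ennreal (c * r ^ DIM(real ^ 'n))"
      proof (cases "r < 3 * d")
        case True
        have "gE y * indicator (cball x r) y = 0" for y
        proof (cases "y \<in> cube a h")
          case in_cube: True
          have "dist a y \<le> d"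
            using dist_cube_le[OF corner_in_cube[OF h] in_cube] by (simp add: d_def)
          moreover have "dist a x \<le> dist a y + dist x y" by (metis dist_commute dist_triangle)
          ultimately have "y \<notin> cball x r" using x True by (simp add: d_def)
          then show ?thesis by simp
        qed (simp add: supp)
        then show ?thesis by (simp only: nn_integral_const) simp
      next
        case False
        have "(\<integral>\<^sup>+ y \<in> cball x r. gE y \<partial>lebesgue) \<le> (\<integral>\<^sup>+ y. gE y \<partial>lebesgue)"
          by (intro nn_integral_mono) (auto split: split_indicator)
        also have "\<dots> = ennreal J" using J by (simp add: gE_def)
        also have "J \<le> c * r ^ DIM(real ^ 'n)"
        proof -
          have "exp 1 * d ^ ?n \<le> 3 * d ^ ?n" using exp_le d by (intro mult_right_mono) auto
          also have "(3::real) \<le> 3 ^ ?n" by (rule self_le_power) auto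
          then have "3 * d ^ ?n \<le> 3 ^ ?n * d ^ ?n" using d by (intro mult_right_mono) auto
          also have "\<dots> = (3 * d) ^ ?n" by (simp add: power_mult_distrib)
          also have "\<dots> \<le> r ^ ?n" using False d by (intro power_mono) auto
          finally have "J * (exp 1 * d ^ ?n) \<le> J * r ^ ?n" using J by (intro mult_left_mono) auto
          then show ?thesis using d by (simp add: c_def field_simps)
        qed
        then have "ennreal J \<le> ennreal (c * r ^ DIM(real ^ 'n))" by (rule ennreal_leI)
        finally show ?thesis .
      qed
    qed
    then have "m x \<le> c" using c by (simp add: m)
    then show ?thesis using c by (simp add: b_def max_def)
  qed
  moreover have "AE x in lebesgue. w / 2 * ?n ^ ?n * h ^ ?n * g x \<le> J * exp (b x)"
  proof -
    have "AE x in lebesgue. ennreal (w / 2) * gE x \<le> maximal gE x"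
      using AE_le_maximal[of gE] by (simp add: w_def)
    then show ?thesis
    proof (rule AE_mp, intro AE_I2 impI)
      fix x assume "ennreal (w / 2) * gE x \<le> maximal gE x"
      moreover have "ennreal (w / 2 * g x) = ennreal (w / 2) * ennreal (g x)"
        using w g(1)[of x] by (intro ennreal_mult) auto
      ultimately have "ennreal (w / 2 * g x) \<le> ennreal (m x)"
        by (simp add: m gE_def)
      then have le: "w / 2 * g x \<le> m x" by (simp add: m_def)
      have "m x * d ^ ?n \<le> m x * (exp 1 * d ^ ?n)"
        using d one_le_exp_iff[of "1::real"] by (intro mult_left_mono) (auto simp: m_def)
      also have "\<dots> = J * (m x / c)" using J d by (simp add: c_def)
      also have "\<dots> \<le> J * exp (b x)"
        unfolding exp_b using J c by (intro mult_left_mono divide_right_mono) auto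
      finally have "m x * d ^ ?n \<le> J * exp (b x)" .
      moreover have "w / 2 * g x * d ^ ?n \<le> m x * d ^ ?n"
        using le d by (intro mult_right_mono) auto
      ultimately show "w / 2 * ?n ^ ?n * h ^ ?n * g x \<le> J * exp (b x)"
        by (simp add: d_def power_mult_distrib mult_ac)
    qed
  qed
  ultimately show thesis
    using that[of b "ln (max (G * w) c / c)"] unfolding w_def by blast
qed

section \<open>Lower bounds away from the support\<close>

text \<open>At a zero of \<open>b\<close> the first term of every commutator vanishes. The induction
  varies \<open>f\<close>, because each step moves one factor \<open>b\<close> into the argument and
  a sign out.\<close>

lemma iter_commutator_at_zero:
  assumes "b x = 0"
  shows "iter_commutator T b m f x = (- 1) ^ m * T (\<lambda>y. of_real (b y) ^ m * f y) x"
  using assms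
proof (induction m arbitrary: f)
  case (Suc m)
  have "iter_commutator T b (Suc m) f x = - iter_commutator T b m (\<lambda>y. of_real (b y) * f y) x"
    using Suc.prems by (simp add: iter_commutator_def commutator_def)
  then show ?case
    using Suc by (simp add: mult_ac)
qed (simp add: iter_commutator_def)

lemma enn_powr_less_top: "enn_powr t r < \<infinity> \<longleftrightarrow> t < \<infinity>"
  by (auto simp: enn_powr_def less_top)

lemma of_real_in_L2:
  fixes F :: "real ^ 'n \<Rightarrow> real"
  assumes [measurable]: "F \<in> borel_measurable lebesgue" "S \<in> sets lebesgue"
    and fin: "emeasure lebesgue S < \<infinity>"
    and F: "\<And>y. \<bar>F y\<bar> \<le> B" "\<And>y. y \<notin> S \<Longrightarrow> F y = 0"
  shows "(\<lambda>y. of_real (F y) :: 'k::{real_normed_field, second_countable_topology}) \<in> L2"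
proof -
  have "(\<integral>\<^sup>+ x. ennreal (norm (of_real (F x) :: 'k) powr 2 * 1) \<partial>lebesgue)
      \<le> (\<integral>\<^sup>+ x \<in> S. ennreal (B\<^sup>2) \<partial>lebesgue)"
    using F power_mono[OF F(1), where n = 2]
    by (intro nn_integral_mono) (auto split: split_indicator intro!: ennreal_leI)
  also have "\<dots> = ennreal (B\<^sup>2) * emeasure lebesgue S"
    by (subst nn_integral_cmult_indicator) auto
  also have "\<dots> < \<infinity>"
    using fin by (simp add: ennreal_mult_less_top)
  finally show ?thesis
    unfolding L2_def lp_norm_def enn_powr_less_top by simp
qed


section \<open>Kernel regularity and the choice of the far cube\<close>

context
  fixes T :: "(real ^ 'n \<Rightarrow> 'k) \<Rightarrow> real ^ 'n \<Rightarrow> 'k::{real_normed_field, banach, second_countable_topology}"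
    and \<omega> :: "real \<Rightarrow> real" and K :: "real ^ 'n \<Rightarrow> real ^ 'n \<Rightarrow> 'k"
  assumes cz: "cz_operator \<omega> K T" and small: "(\<omega> \<longlongrightarrow> 0) (at_right 0)"
begin

lemma modulus_small:
  assumes "0 < e"
  obtains \<delta> where "0 < \<delta>" "\<delta> \<le> 1" "\<And>t. 0 \<le> t \<Longrightarrow> t < \<delta> \<Longrightarrow> \<omega> t < e"
proof -
  have "eventually (\<lambda>t. \<omega> t < e) (at_right 0)"
    using small assms by (rule order_tendstoD)
  then obtain b where b: "0 < b" "\<And>t. 0 < t \<Longrightarrow> t < b \<Longrightarrow> \<omega> t < e"
    by (auto simp: eventually_at_right_field)
  have "\<omega> 0 = 0" using cz by (simp add: cz_operator_def modulus_of_continuity_def)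
  then show thesis
    using that[of "min b 1"] b assms by (metis less_eq_real_def min.cobounded2 min_less_iff_conj zero_less_one)
qed

lemma kernel_difference:
  assumes "2 * norm (x - x') < norm (x - y)"
  shows "norm (K x y - K x' y) \<le> \<omega> (norm (x - x') / norm (x - y)) / norm (x - y) ^ CARD('n)"
    and "norm (K y x - K y x') \<le> \<omega> (norm (x - x') / norm (x - y)) / norm (x - y) ^ CARD('n)"
proof -
  have "norm (K x y - K x' y) + norm (K y x - K y x')
      \<le> \<omega> (norm (x - x') / norm (x - y)) / norm (x - y) ^ CARD('n)"
    using cz assms unfolding cz_operator_def cz_kernel_def by blast
  then show "norm (K x y - K x' y) \<le> \<omega> (norm (x - x') / norm (x - y)) / norm (x - y) ^ CARD('n)"
    "norm (K y x - K y x') \<le> \<omega> (norm (x - x') / norm (x - y)) / norm (x - y) ^ CARD('n)"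
    by (smt (verit) norm_ge_zero)+
qed

text \<open>Supplies the measurability of \<open>K x\<close> on a cube away from \<open>x\<close>:
  the definition of a kernel gives only size and smoothness, and continuity off the diagonal follows
  once the modulus tends to 0.\<close>

lemma isCont_kernel:
  assumes "x \<noteq> y"
  shows "isCont (K x) y"
  unfolding continuous_at_eps_delta
proof (intro allI impI)
  fix e :: real assume e: "0 < e"
  define s where "s = norm (y - x)"
  have s: "0 < s" using assms by (simp add: s_def)
  then obtain \<delta> where \<delta>: "0 < \<delta>" "\<And>t. 0 \<le> t \<Longrightarrow> t < \<delta> \<Longrightarrow> \<omega> t < e * s ^ CARD('n)"
    using modulus_small[of "e * s ^ CARD('n)"] e by (metis mult_pos_pos zero_less_power)
  show "\<exists>d>0. \<forall>z. dist z y < d \<longrightarrow> dist (K x z) (K x y) < e"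
  proof (intro exI[of _ "min (\<delta> * s) (s / 2)"] conjI allI impI)
    fix z assume z: "dist z y < min (\<delta> * s) (s / 2)"
    then have *: "norm (y - z) / s < \<delta>" "2 * norm (y - z) < s"
      using s by (auto simp: dist_norm norm_minus_commute field_simps)
    have "dist (K x z) (K x y) \<le> \<omega> (norm (y - z) / s) / s ^ CARD('n)"
      using kernel_difference(2)[of y z x] *(2)
      by (simp add: s_def dist_norm norm_minus_commute)
    also have "\<dots> < e"
      using \<delta>(2)[OF _ *(1)] s by (simp add: divide_less_eq)
    finally show "dist (K x z) (K x y) < e" .
  qed (use \<delta> s in auto)
qed

text \<open>Freezing the kernel at the value \<open>k\<close> turns \<open>T F\<close> into
  \<open>k\<close> times the integral of \<open>F\<close>. As \<open>F\<close> is nonnegative, the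
  error is at most \<kappa> times that integral, half of what \<open>norm k\<close> guarantees, so
  nothing cancels even for complex scalars.\<close>

lemma operator_lower_bound:
  fixes F :: "real ^ 'n \<Rightarrow> real" and h \<kappa> d :: real
  defines "d \<equiv> CARD('n) * h"
  assumes h: "0 < h" and far: "\<And>x. x \<in> P \<Longrightarrow> d < dist a x"
    and flat: "\<And>x y. x \<in> P \<Longrightarrow> y \<in> cube a h \<Longrightarrow> norm (K x y - k) \<le> \<kappa>" "2 * \<kappa> \<le> norm k"
    and [measurable]: "F \<in> borel_measurable lebesgue"
    and F: "\<And>y. 0 \<le> F y" "\<And>y. F y \<le> B" "\<And>y. y \<notin> cube a h \<Longrightarrow> F y = 0"
  shows "AE x in lebesgue. x \<in> P \<longrightarrow> \<kappa> * (LINT y|lebesgue. F y) \<le> norm (T (\<lambda>y. of_real (F y)) x)"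
proof -
  let ?F = "\<lambda>y. of_real (F y) :: 'k"
  have sub: "cube a h \<subseteq> cball a d"
    using cube_subset_cball[OF corner_in_cube[OF h, of a]] by (simp add: d_def)
  have L2: "?F \<in> L2"
    using F cube_lmeasurable[OF h, of a]
    by (intro of_real_in_L2[of F "cube a h" B]) (auto simp: fmeasurable_def)
  have supp: "closure {y. ?F y \<noteq> 0} \<subseteq> cball a d"
  proof (rule closure_minimal)
    show "{y. ?F y \<noteq> 0} \<subseteq> cball a d"
      using F(3) sub by auto
  qed simp
  have intF: "integrable lebesgue F"
  proof (rule Bochner_Integration.integrable_bound)
    show "integrable lebesgue (\<lambda>y. indicator (cube a h) y * B :: real)"
      using cube_lmeasurable[OF h, of a] by (auto simp: fmeasurable_def)
    show "AE y in lebesgue. norm (F y) \<le> norm (indicator (cube a h) y * B :: real)"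
      using F order_trans[OF F(2) abs_ge_self] by (intro AE_I2) (auto simp: indicator_def)
  qed measurable
  have "AE x in lebesgue. x \<notin> closure {y. ?F y \<noteq> 0} \<longrightarrow> T ?F x = (LINT y|lebesgue. K x y * ?F y)"
  proof -
    have "\<forall>f\<in>L2. AE x in lebesgue. x \<notin> closure {y. f y \<noteq> 0} \<longrightarrow>
        T f x = (LINT y|lebesgue. K x y * f y)"
      using cz unfolding cz_operator_def by (elim conjE)
    then show ?thesis using L2 by (rule bspec)
  qed
  then show ?thesis
  proof (rule AE_mp, intro AE_I2 impI)
    fix x assume *: "x \<notin> closure {y. ?F y \<noteq> 0} \<longrightarrow> T ?F x = (LINT y|lebesgue. K x y * ?F y)"
    assume x: "x \<in> P"
    have "x \<notin> cball a d" using far[OF x] by simp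
    then have T: "T ?F x = (LINT y|lebesgue. K x y * ?F y)" using * supp by auto
    have "continuous_on (cube a h) (K x)"
    proof (intro continuous_at_imp_continuous_on ballI isCont_kernel)
      fix y assume "y \<in> cube a h"
      then show "x \<noteq> y"
        using \<open>x \<notin> cball a d\<close> sub by auto
    qed
    then have "(\<lambda>y. indicat_real (cube a h) y *\<^sub>R K x y) \<in> borel_measurable borel"
      by (intro borel_measurable_continuous_on_indicator) auto
    then have [measurable]: "(\<lambda>y. indicat_real (cube a h) y *\<^sub>R K x y) \<in> borel_measurable lebesgue"
      by (simp add: measurable_completion)
    \<comment> \<open>Continuity of \<open>K x\<close> is available on the cube only, so
      measurability of the product goes through the cut-off kernel; \<open>F\<close> vanishes
      elsewhere.\<close>
    have diff: "(\<lambda>y. (indicat_real (cube a h) y *\<^sub>R K x y - k) * ?F y) = (\<lambda>y. (K x y - k) * ?F y)"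
      using F(3) by (auto simp: fun_eq_iff indicator_def)
    have meas: "(\<lambda>y. (K x y - k) * ?F y) \<in> borel_measurable lebesgue"
      unfolding diff[symmetric] by measurable
    have le: "norm ((K x y - k) * ?F y) \<le> \<kappa> * F y" for y
      using flat(1)[OF x, of y] F(1)[of y] F(3)[of y]
      by (cases "y \<in> cube a h") (auto simp: norm_mult intro!: mult_right_mono)
    have int: "integrable lebesgue (\<lambda>y. (K x y - k) * ?F y)"
    proof (rule Bochner_Integration.integrable_bound[OF _ meas])
      show "integrable lebesgue (\<lambda>y. \<kappa> * F y)" using intF by (rule integrable_mult_right)
      show "AE y in lebesgue. norm ((K x y - k) * ?F y) \<le> norm (\<kappa> * F y)"
        unfolding real_norm_def by (rule AE_I2) (rule order_trans[OF le abs_ge_self])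
    qed
    have intk: "integrable lebesgue (\<lambda>y. k * ?F y)"
      using intF by (intro integrable_mult_right integrable_of_real) auto
    have "T ?F x = (LINT y|lebesgue. (K x y - k) * ?F y + k * ?F y)"
      unfolding T by (rule Bochner_Integration.integral_cong) (auto simp: algebra_simps)
    also have "\<dots> = (LINT y|lebesgue. (K x y - k) * ?F y) + k * of_real (LINT y|lebesgue. F y)"
      using int intk intF by (subst Bochner_Integration.integral_add) (auto simp: integral_of_real)
    finally have eq: "T ?F x = \<dots>" .
    have "norm (LINT y|lebesgue. (K x y - k) * ?F y) \<le> (LINT y|lebesgue. norm ((K x y - k) * ?F y))"
      by (rule integral_norm_bound)
    also have "\<dots> \<le> (LINT y|lebesgue. \<kappa> * F y)"
      using int intF le by (intro integral_mono) auto
    also have "\<dots> = \<kappa> * (LINT y|lebesgue. F y)" by simp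
    finally have err: "norm (LINT y|lebesgue. (K x y - k) * ?F y) \<le> \<kappa> * (LINT y|lebesgue. F y)" .
    have I: "0 \<le> (LINT y|lebesgue. F y)" using F by (intro integral_nonneg_AE) auto
    have "2 * \<kappa> * (LINT y|lebesgue. F y) \<le> norm k * (LINT y|lebesgue. F y)"
      using flat(2) I by (intro mult_right_mono)
    also have "\<dots> = norm (k * of_real (LINT y|lebesgue. F y))"
      using I by (simp add: norm_mult)
    also have "\<dots> \<le> norm (T ?F x) + norm (LINT y|lebesgue. (K x y - k) * ?F y)"
      using norm_triangle_ineq4[of "T ?F x" "LINT y|lebesgue. (K x y - k) * ?F y"] eq by simp
    finally show "\<kappa> * (LINT y|lebesgue. F y) \<le> norm (T ?F x)"
      using err by linarith
  qed
qed

text \<open>Far away compared with the side length, moving both arguments within their cubes is a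
  small relative perturbation, so the modulus makes the kernel nearly constant. The distance must
  nevertheless stay comparable to \<open>h\<close>, which the upper size bound enforces.\<close>

lemma far_flat_cube:
  assumes "nondegenerate_kernel \<omega> K"
  obtains \<kappa> \<Lambda> :: real where "0 < \<kappa>" "\<And>a (h::real). 0 < h \<Longrightarrow> \<exists>x0. 6 * (CARD('n) * h) \<le> dist a x0 \<and>
    dist a x0 \<le> \<Lambda> * h \<and> 2 * (\<kappa> / h ^ CARD('n)) \<le> norm (K x0 a) \<and>
    (\<forall>x\<in>cube x0 h. \<forall>y\<in>cube a h. norm (K x y - K x0 a) \<le> \<kappa> / h ^ CARD('n))"
proof -
  let ?n = "CARD('n)"
  obtain c0 where c0: "0 < c0" "\<And>y r. 0 < r \<Longrightarrow> \<exists>x. x \<notin> ball y r \<and> c0 / r ^ ?n \<le> norm (K x y)"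
    using assms unfolding nondegenerate_kernel_def by blast
  obtain C where C: "\<And>x y. x \<noteq> y \<Longrightarrow> norm (K x y) \<le> C / norm (x - y) ^ ?n"
    using cz unfolding cz_operator_def cz_kernel_def by blast
  \<comment> \<open>The factor \<open>2 ^ n\<close> pays for distances that may drop to half of
    \<open>A * d\<close>. The 4 makes each of the two increments, one per variable, a quarter of the
    lower bound for the kernel.\<close>
  define e where "e = c0 / (4 * 2 ^ ?n)"
  have "0 < e" using c0 by (simp add: e_def)
  then obtain \<delta> where \<delta>: "0 < \<delta>" "\<delta> \<le> 1" "\<And>t. 0 \<le> t \<Longrightarrow> t < \<delta> \<Longrightarrow> \<omega> t < e"
    using modulus_small by blast
  \<comment> \<open>The 7 leaves distance \<open>6 * d\<close> after moving by \<open>d\<close>; the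
    term \<open>2 / \<delta>\<close> brings displacement over distance below \<delta>.\<close>
  define A where "A = 7 + 2 / \<delta>"
  have A: "7 \<le> A" "2 / \<delta> < A" using \<delta> by (auto simp: A_def)
  define \<kappa> where "\<kappa> = c0 / (2 * (A * ?n) ^ ?n)"
  have \<kappa>: "0 < \<kappa>" using c0 A by (simp add: \<kappa>_def)
  show thesis
  proof (rule that[of \<kappa> "C / c0 * (A * ?n)"])
    fix a :: "real ^ 'n" and h :: real assume h: "0 < h"
    define d where "d = ?n * h"
    have d: "0 < d" using h by (simp add: d_def)
    have r: "0 < A * d" using A d by simp
    obtain x0 where x0: "x0 \<notin> ball a (A * d)" "c0 / (A * d) ^ ?n \<le> norm (K x0 a)"
      using c0(2)[OF r] by blast
    have far: "A * d \<le> norm (x0 - a)"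
      using x0(1) by (simp add: dist_norm norm_minus_commute)
    have \<kappa>_eq: "\<kappa> / h ^ ?n = c0 / (A * d) ^ ?n / 2"
      by (simp add: \<kappa>_def d_def power_mult_distrib field_simps)
    \<comment> \<open>Upper and lower bounds for \<open>K x0 a\<close> together give
      \<open>q ^ n \<le> C / c0\<close>, and \<open>q \<ge> 1\<close> lets the power be
      dropped.\<close>
    have near: "norm (x0 - a) \<le> C / c0 * (A * ?n) * h"
    proof -
      define q where "q = norm (x0 - a) / (A * d)"
      have q: "1 \<le> q" using far r by (simp add: q_def le_divide_eq)
      have pos: "0 < norm (x0 - a)" using far r by linarith
      have "c0 / (A * d) ^ ?n \<le> C / norm (x0 - a) ^ ?n"
        using x0(2) C[of x0 a] pos by fastforce
      then have "norm (x0 - a) ^ ?n / (A * d) ^ ?n \<le> C / c0"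
        using pos r c0(1) by (simp add: field_simps)
      then have "q ^ ?n \<le> C / c0" by (simp add: q_def power_divide)
      moreover have "q \<le> q ^ ?n" using q by (intro self_le_power) auto
      ultimately have "q * (A * d) \<le> C / c0 * (A * d)" using r by (intro mult_right_mono) auto
      moreover have "q * (A * d) = norm (x0 - a)" using A d by (simp add: q_def)
      ultimately show ?thesis by (simp add: d_def mult_ac)
    qed
    have small_term: "\<omega> (s / t) / t ^ ?n \<le> \<kappa> / h ^ ?n / 2"
      if "0 \<le> s" "s \<le> d" "A / 2 * d \<le> t" for s t
    proof -
      have t: "0 < t" using that(3) A d by (smt (verit) divide_pos_pos mult_pos_pos)
      have "s / t < \<delta>"
      proof -
        have "2 / \<delta> * d < A * d" using A d by (intro mult_strict_right_mono) auto
        then have "d < \<delta> * (A / 2 * d)" using \<delta> by (simp add: field_simps)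
        also have "\<dots> \<le> \<delta> * t" using that \<delta> by (intro mult_left_mono) auto
        finally show ?thesis using that(2) t by (simp add: divide_less_eq)
      qed
      then have "\<omega> (s / t) / t ^ ?n \<le> e / t ^ ?n"
        using \<delta>(3)[of "s / t"] that t by (intro divide_right_mono) auto
      also have "\<dots> \<le> e / (A / 2 * d) ^ ?n"
        using that t A d \<open>0 < e\<close> by (intro divide_left_mono power_mono mult_pos_pos zero_less_power) auto
      also have "\<dots> = \<kappa> / h ^ ?n / 2"
        unfolding \<kappa>_eq e_def by (simp add: power_mult_distrib power_divide)
      finally show ?thesis .
    qed
    have "norm (K x y - K x0 a) \<le> \<kappa> / h ^ ?n" if x: "x \<in> cube x0 h" and y: "y \<in> cube a h" for x y
    proof -
      have x0x: "norm (x0 - x) \<le> d"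
        using dist_cube_le[OF corner_in_cube[OF h] x] by (simp add: d_def dist_norm)
      have ay: "norm (a - y) \<le> d"
        using dist_cube_le[OF corner_in_cube[OF h] y] by (simp add: d_def dist_norm)
      have Ad: "7 * d \<le> A * d" using A d by (intro mult_right_mono) auto
      have "norm (x0 - a) \<le> norm (x0 - x) + norm (a - x)"
        using norm_triangle_ineq4[of "x0 - x" "a - x"] by simp
      then have ax: "A / 2 * d \<le> norm (a - x)" "6 * d \<le> norm (a - x)"
        using far x0x Ad d by linarith+
      have "norm (K x y - K x a) \<le> \<omega> (norm (a - y) / norm (a - x)) / norm (a - x) ^ ?n"
        using kernel_difference(2)[of a y x] ax ay d by (simp add: norm_minus_commute)
      also have "\<dots> \<le> \<kappa> / h ^ ?n / 2"
        using ay ax by (intro small_term) auto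
      \<comment> \<open>Half of the allowed error is spent on moving \<open>y\<close> to
        \<open>a\<close>, the other half on moving \<open>x\<close> to \<open>x0\<close>.\<close>
      finally have 1: "norm (K x y - K x a) \<le> \<kappa> / h ^ ?n / 2" .
      have "norm (K x a - K x0 a) \<le> \<omega> (norm (x0 - x) / norm (x0 - a)) / norm (x0 - a) ^ ?n"
      proof -
        have "2 * norm (x0 - x) < norm (x0 - a)" using far x0x Ad d by linarith
        then show ?thesis using kernel_difference(1)[of x0 x a] by (simp add: norm_minus_commute)
      qed
      also have "\<dots> \<le> \<kappa> / h ^ ?n / 2"
        using x0x far r norm_ge_zero[of "x0 - x"] by (intro small_term; linarith)
      finally have "norm (K x a - K x0 a) \<le> \<kappa> / h ^ ?n / 2" .
      then show ?thesis
        using 1 norm_triangle_ineq[of "K x y - K x a" "K x a - K x0 a"] by simp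
    qed
    moreover have "6 * d \<le> A * d" using A d by (intro mult_right_mono) auto
    then have "6 * (?n * h) \<le> dist a x0"
      using far unfolding d_def dist_norm norm_minus_commute[of a] by linarith
    ultimately show "\<exists>x0. 6 * (?n * h) \<le> dist a x0 \<and> dist a x0 \<le> C / c0 * (A * ?n) * h \<and>
        2 * (\<kappa> / h ^ ?n) \<le> norm (K x0 a) \<and>
        (\<forall>x\<in>cube x0 h. \<forall>y\<in>cube a h. norm (K x y - K x0 a) \<le> \<kappa> / h ^ ?n)"
      using far near x0(2) \<kappa>_eq
      by (intro exI[of _ x0]) (auto simp: dist_norm norm_minus_commute d_def)
  qed (rule \<kappa>)
qed

end

text \<open>The order of quantifiers matters: \<kappa> and \<Lambda> do not depend on the cube, and
  the far cube is fixed before the test function, which will itself be built around that cube's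
  distance.\<close>

lemma operator_lower_bound_far_cube:
  fixes T :: "(real ^ 'n \<Rightarrow> 'k) \<Rightarrow> real ^ 'n \<Rightarrow> 'k::{real_normed_field, banach, second_countable_topology}"
  assumes "nondegenerate_cz_operator T"
  obtains \<kappa> \<Lambda> :: real where "0 < \<kappa>" "\<And>a (h::real). 0 < h \<Longrightarrow> \<exists>x0. 6 * (CARD('n) * h) \<le> dist a x0 \<and>
    dist a x0 \<le> \<Lambda> * h \<and>
    (\<forall>F B. F \<in> borel_measurable lebesgue \<longrightarrow> (\<forall>y. 0 \<le> F y \<and> F y \<le> B) \<longrightarrow> (\<forall>y. y \<notin> cube a h \<longrightarrow> F y = 0) \<longrightarrow>
      (AE x in lebesgue. x \<in> cube x0 h \<longrightarrow>
        \<kappa> / h ^ CARD('n) * (LINT y|lebesgue. F y) \<le> norm (T (\<lambda>y. of_real (F y)) x)))"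
proof -
  obtain \<omega> K where K: "cz_operator \<omega> K T" "nondegenerate_kernel \<omega> K"
    using assms unfolding nondegenerate_cz_operator_def by blast
  then have \<omega>: "(\<omega> \<longlongrightarrow> 0) (at_right 0)" by (simp add: nondegenerate_kernel_def)
  obtain \<kappa> \<Lambda> :: real where \<kappa>: "0 < \<kappa>" "\<And>a (h::real). 0 < h \<Longrightarrow> \<exists>x0. 6 * (CARD('n) * h) \<le> dist a x0 \<and>
    dist a x0 \<le> \<Lambda> * h \<and> 2 * (\<kappa> / h ^ CARD('n)) \<le> norm (K x0 a) \<and>
    (\<forall>x\<in>cube x0 h. \<forall>y\<in>cube a h. norm (K x y - K x0 a) \<le> \<kappa> / h ^ CARD('n))"
    using far_flat_cube[OF K(1) \<omega> K(2)] by blast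
  show thesis
  proof (rule that[OF \<kappa>(1)])
    fix a :: "real ^ 'n" and h :: real assume h: "0 < h"
    obtain x0 where x0: "6 * (CARD('n) * h) \<le> dist a x0" "dist a x0 \<le> \<Lambda> * h"
      "2 * (\<kappa> / h ^ CARD('n)) \<le> norm (K x0 a)"
      "\<And>x y. x \<in> cube x0 h \<Longrightarrow> y \<in> cube a h \<Longrightarrow> norm (K x y - K x0 a) \<le> \<kappa> / h ^ CARD('n)"
      using \<kappa>(2)[OF h] by blast
    have far: "CARD('n) * h < dist a x" if "x \<in> cube x0 h" for x
    proof -
      have "dist x0 x \<le> CARD('n) * h" by (rule dist_cube_le[OF corner_in_cube[OF h] that])
      moreover have "dist a x0 \<le> dist a x + dist x0 x" by (metis dist_commute dist_triangle)
      moreover have "0 < CARD('n) * h" using h by simp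
      ultimately show ?thesis using x0(1) by linarith
    qed
    show "\<exists>x0. 6 * (CARD('n) * h) \<le> dist a x0 \<and> dist a x0 \<le> \<Lambda> * h \<and>
    (\<forall>F B. F \<in> borel_measurable lebesgue \<longrightarrow> (\<forall>y. 0 \<le> F y \<and> F y \<le> B) \<longrightarrow> (\<forall>y. y \<notin> cube a h \<longrightarrow> F y = 0) \<longrightarrow>
      (AE x in lebesgue. x \<in> cube x0 h \<longrightarrow>
        \<kappa> / h ^ CARD('n) * (LINT y|lebesgue. F y) \<le> norm (T (\<lambda>y. of_real (F y)) x)))"
    proof (intro exI[of _ x0] conjI allI impI x0)
      fix F :: "real ^ 'n \<Rightarrow> real" and B
      assume F: "F \<in> borel_measurable lebesgue" "\<forall>y. 0 \<le> F y \<and> F y \<le> B" "\<forall>y. y \<notin> cube a h \<longrightarrow> F y = 0"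
      show "AE x in lebesgue. x \<in> cube x0 h \<longrightarrow>
        \<kappa> / h ^ CARD('n) * (LINT y|lebesgue. F y) \<le> norm (T (\<lambda>y. of_real (F y)) x)"
        using F by (intro operator_lower_bound[OF K(1) \<omega> h far x0(4) x0(3)]) auto
    qed
  qed
qed

section \<open>Weights and Luxemburg norms\<close>

lemma locally_integrable_measurable:
  fixes f :: "real ^ 'n \<Rightarrow> real"
  assumes "locally_integrable f"
  shows "f \<in> borel_measurable lebesgue"
proof (rule borel_measurable_LIMSEQ_real)
  fix x :: "real ^ 'n"
  obtain k :: nat where k: "norm x \<le> real k" using real_arch_simple by blast
  have "eventually (\<lambda>i. indicat_real (cball 0 (real i)) x *\<^sub>R f x = f x) sequentially"
    using k by (intro eventually_sequentiallyI[of k]) (auto simp: indicator_def)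
  then show "(\<lambda>i. indicat_real (cball 0 (real i)) x *\<^sub>R f x) \<longlonglongrightarrow> f x"
    by (rule tendsto_eventually)
next
  fix i :: nat
  have "set_integrable lebesgue (cball 0 (real i)) f"
    using assms by (simp add: locally_integrable_def)
  then show "(\<lambda>x. indicat_real (cball 0 (real i)) x *\<^sub>R f x) \<in> borel_measurable lebesgue"
    unfolding set_integrable_def by (rule borel_measurable_integrable)
qed

lemma wmeas_cube_finite:
  fixes a :: "real ^ 'n" and h :: real
  assumes "weight w" "0 < h"
  shows "wmeas w (cube a h) < \<infinity>"
proof -
  have "set_integrable lebesgue (cball a (CARD('n) * h)) w"
    using assms by (simp add: weight_def locally_integrable_def)
  then have "set_integrable lebesgue (cube a h) w"
    by (rule set_integrable_subset) (use cube_subset_cball[OF corner_in_cube[OF assms(2), of a]] in auto)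
  then have "integrable lebesgue (\<lambda>x. indicat_real (cube a h) x *\<^sub>R w x)"
    by (simp add: set_integrable_def)
  then have "(\<integral>\<^sup>+ x. ennreal (norm (indicat_real (cube a h) x *\<^sub>R w x)) \<partial>lebesgue) < \<infinity>"
    by (simp only: integrable_iff_bounded)
  moreover have "wmeas w (cube a h) = (\<integral>\<^sup>+ x. ennreal (norm (indicat_real (cube a h) x *\<^sub>R w x)) \<partial>lebesgue)"
    unfolding wmeas_def using assms
    by (intro nn_integral_cong) (auto simp: weight_def split: split_indicator)
  ultimately show ?thesis by simp
qed

lemma wmeas_mono: "A \<subseteq> B \<Longrightarrow> wmeas u A \<le> wmeas u B"
  unfolding wmeas_def by (rule set_nn_integral_mono_set)

text \<open>The corner moves by \<open>(2 ^ k - 1) * h / 2\<close>, exactly what keeps the centre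
  fixed under all dilations.\<close>

lemma doubling_iterate:
  fixes a :: "real ^ 'n" and h c :: real
  assumes c: "0 < c"
    and dbl: "\<And>(a :: real ^ 'n) h. 0 < h \<Longrightarrow>
      wmeas u (cube (\<chi> i. a $ i - h / 2) (2 * h)) \<le> ennreal c * wmeas u (cube a h)"
    and h: "0 < h"
  shows "wmeas u (cube (\<chi> i. a $ i - (2 ^ k - 1) * h / 2) (2 ^ k * h)) \<le> ennreal (c ^ k) * wmeas u (cube a h)"
proof (induction k)
  case (Suc k)
  let ?a = "\<chi> i. a $ i - (2 ^ k - 1) * h / 2"
  have "(\<chi> i. a $ i - (2 ^ Suc k - 1) * h / 2) = (\<chi> i. ?a $ i - (2 ^ k * h) / 2)"
    by (simp add: vec_eq_iff field_simps)
  moreover have "2 ^ Suc k * h = 2 * (2 ^ k * h)" by simp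
  ultimately have "wmeas u (cube (\<chi> i. a $ i - (2 ^ Suc k - 1) * h / 2) (2 ^ Suc k * h))
      \<le> ennreal c * wmeas u (cube ?a (2 ^ k * h))"
    using dbl[of "2 ^ k * h" ?a] h by (simp only: zero_less_mult_iff zero_less_power zero_less_numeral) simp
  also have "\<dots> \<le> ennreal c * (ennreal (c ^ k) * wmeas u (cube a h))"
    by (intro mult_left_mono Suc) simp
  also have "\<dots> = ennreal (c ^ Suc k) * wmeas u (cube a h)"
    using c by (simp add: ennreal_mult mult.assoc)
  finally show ?case .
qed simp

lemma doubling_compare:
  fixes u :: "real ^ 'n \<Rightarrow> real" and \<Lambda> :: real
  assumes "doubling u"
  obtains D :: real where "0 < D" "\<And>a x0 h. 0 < h \<Longrightarrow> dist a x0 \<le> \<Lambda> * h \<Longrightarrow>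
    wmeas u (cube a h) \<le> ennreal D * wmeas u (cube x0 h)"
proof -
  obtain c :: real where c: "0 < c" "\<And>(a :: real ^ 'n) h. 0 < h \<Longrightarrow>
      wmeas u (cube (\<chi> i. a $ i - h / 2) (2 * h)) \<le> ennreal c * wmeas u (cube a h)"
    using assms unfolding doubling_def by blast
  \<comment> \<open>In each coordinate the dilated cube reaches \<open>2 ^ k * h / 2\<close> from
    its centre, while the points to be covered are at most \<Lambda> h + h / 2 away; the 3 leaves
    some slack.\<close>
  obtain k where k: "2 * \<Lambda> + 3 < 2 ^ k"
    using real_arch_pow[of 2 "2 * \<Lambda> + 3"] by auto
  show thesis
  proof (rule that[of "c ^ k"])
    fix a x0 :: "real ^ 'n" and h :: real assume h: "0 < h" and d: "dist a x0 \<le> \<Lambda> * h"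
    have "cube a h \<subseteq> cube (\<chi> i. x0 $ i - (2 ^ k - 1) * h / 2) (2 ^ k * h)"
    proof
      fix y assume y: "y \<in> cube a h"
      have "(2 * \<Lambda> + 3) * h \<le> 2 ^ k * h" using k h by (intro mult_right_mono) auto
      then have kh: "2 * (\<Lambda> * h) + 3 * h \<le> 2 ^ k * h" by (simp add: algebra_simps)
      have "x0 $ i - (2 ^ k - 1) * h / 2 \<le> y $ i \<and> y $ i < x0 $ i - (2 ^ k - 1) * h / 2 + 2 ^ k * h" for i
      proof -
        have "\<bar>a $ i - x0 $ i\<bar> \<le> \<Lambda> * h"
          using component_le_norm_cart[of "a - x0" i] d by (simp add: dist_norm)
        moreover have "a $ i \<le> y $ i" "y $ i < a $ i + h" using y by (auto simp: cube_def)
        moreover have "(2 ^ k - 1) * h / 2 = 2 ^ k * h / 2 - h / 2" by (simp add: field_simps)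
        ultimately show ?thesis using kh h by linarith
      qed
      then show "y \<in> cube (\<chi> i. x0 $ i - (2 ^ k - 1) * h / 2) (2 ^ k * h)"
        by (simp add: cube_def)
    qed
    then show "wmeas u (cube a h) \<le> ennreal (c ^ k) * wmeas u (cube x0 h)"
      using doubling_iterate[OF c h, of x0 k] by (meson order_trans wmeas_mono)
  qed (use c in simp)
qed

section \<open>Weak norms, Luxemburg norms and the regularised weight\<close>

lemma enn_powr_mono: "s \<le> t \<Longrightarrow> 0 \<le> r \<Longrightarrow> enn_powr s r \<le> enn_powr t r"
  by (auto simp: enn_powr_def top_unique less_top intro!: ennreal_leI powr_mono2 enn2real_mono)

lemma enn_powr_ennreal: "0 \<le> t \<Longrightarrow> enn_powr (ennreal t) r = ennreal (t powr r)"
  by (simp add: enn_powr_def)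

lemma weak_lp_norm_ge:
  assumes "0 < s" "0 < p" "AE x in lebesgue. x \<in> P \<longrightarrow> s < norm (g x)"
  shows "ennreal s * enn_powr (wmeas u P) (1 / p) \<le> weak_lp_norm p u g"
proof -
  have "wmeas u P \<le> wmeas u {x. norm (g x) > s}"
    unfolding wmeas_def
    by (rule nn_integral_mono_AE) (use assms(3) in \<open>auto split: split_indicator\<close>)
  then have "ennreal s * enn_powr (wmeas u P) (1 / p) \<le> ennreal s * enn_powr (wmeas u {x. norm (g x) > s}) (1 / p)"
    using assms by (intro mult_left_mono enn_powr_mono) auto
  also have "\<dots> \<le> weak_lp_norm p u g"
    unfolding weak_lp_norm_def using assms by (intro SUP_upper) auto
  finally show ?thesis .
qed

lemma conjugate_exponent:
  fixes p p' :: real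
  assumes "1 < p" "1 / p + 1 / p' = 1"
  shows "1 < p'" "(p' - 1) * p = p'" "(1 - p') * (p - 1) = - 1" "(1 - p') / p' = - 1 / p"
proof -
  have p': "p' \<noteq> 0" using assms by auto
  then have e: "p' + p = p * p'" using assms by (simp add: field_simps)
  have "1 / p < 1" using assms by simp
  then have "0 < 1 / p'" using assms by linarith
  then have pos: "0 < p'" by simp
  have "1 / p' < 1" using assms by (smt (verit) divide_pos_pos)
  then show "1 < p'" using pos by simp
  show "(p' - 1) * p = p'" "(1 - p') * (p - 1) = - 1" using e by (simp_all add: algebra_simps)
  show "(1 - p') / p' = - 1 / p" using e pos assms by (simp add: field_simps)
qed

lemma luxemburg_le:
  assumes "0 < l" "enn_avg (\<lambda>y. \<phi> (g y / ennreal l)) Q \<le> 1"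
  shows "luxemburg \<phi> Q g \<le> ennreal l"
  unfolding luxemburg_def using assms by (intro Inf_lower) auto

text \<open>For a pure power the Luxemburg norm is the L^p mean. The free parameter \<open>l\<close>
  also covers \<open>u(Q) = 0\<close>, where every positive \<open>l\<close> is admissible.\<close>

lemma luxemburg_powr_le:
  fixes a :: "real ^ 'n"
  assumes w: "weight u" and p: "0 < p" and h: "0 < h" and l: "0 < l"
    and le: "wmeas u (cube a h) \<le> ennreal (h ^ CARD('n) * l powr p)"
  shows "luxemburg (\<lambda>t. enn_powr t p) (cube a h) (\<lambda>x. ennreal (u x powr (1 / p))) \<le> ennreal l"
proof (rule luxemburg_le[OF l])
  have u0: "0 \<le> u x" for x using w by (simp add: weight_def)
  have [measurable]: "u \<in> borel_measurable lebesgue"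
    using w by (simp add: weight_def locally_integrable_measurable)
  have "enn_powr (ennreal (u y powr (1 / p)) / ennreal l) p = ennreal (1 / l powr p) * ennreal (u y)" for y
    using u0[of y] l p by (simp add: divide_ennreal enn_powr_ennreal powr_divide powr_powr ennreal_mult[symmetric])
  then have "(\<integral>\<^sup>+ y \<in> cube a h. enn_powr (ennreal (u y powr (1 / p)) / ennreal l) p \<partial>lebesgue)
      = ennreal (1 / l powr p) * wmeas u (cube a h)"
    unfolding wmeas_def by (simp add: mult.assoc nn_integral_cmult)
  also have "\<dots> \<le> ennreal (1 / l powr p) * ennreal (h ^ CARD('n) * l powr p)"
    by (intro mult_left_mono le) simp
  also have "\<dots> = ennreal (1 * h ^ CARD('n))"
    using l h by (simp add: ennreal_mult[symmetric])
  finally show "enn_avg (\<lambda>y. enn_powr (ennreal (u y powr (1 / p)) / ennreal l) p) (cube a h) \<le> 1"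
    using enn_avg_cube_le_iff[OF h, of 1 _ a] by simp
qed

lemma llog_ennreal: "0 \<le> t \<Longrightarrow> llog q \<alpha> (ennreal t) = ennreal (t powr q * ln (exp 1 + t) powr \<alpha>)"
  by (simp add: llog_def)

text \<open>Prepares Fatou's lemma. At zeros of \<open>v\<close> the regularised values tend to
  infinity, in agreement with the convention in \<open>inv_root\<close>.\<close>

lemma llog_inv_root_tendsto:
  fixes v :: "real ^ 'n \<Rightarrow> real" and \<alpha> q p l :: real
  assumes v: "0 \<le> v x" and l: "0 < l" and \<alpha>: "0 \<le> \<alpha>" and p: "0 < p" and q: "0 < q"
  shows "(\<lambda>N. llog q \<alpha> (ennreal ((v x + 1 / real (Suc N)) powr (- 1 / p) / l)))
    \<longlonglongrightarrow> llog q \<alpha> (inv_root p v x / ennreal l)"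
proof -
  define t where "t N = (v x + 1 / real (Suc N)) powr (- 1 / p) / l" for N :: nat
  have eq: "llog q \<alpha> (ennreal (t N)) = ennreal (t N powr q * ln (exp 1 + t N) powr \<alpha>)" for N
    using l by (intro llog_ennreal) (simp add: t_def)
  have lim0: "(\<lambda>N. 1 / real (Suc N)) \<longlonglongrightarrow> 0"
    using LIMSEQ_inverse_real_of_nat by (simp add: inverse_eq_divide)
  show ?thesis
  proof (cases "v x = 0")
    case False
    define t0 where "t0 = v x powr (- 1 / p) / l"
    have t0: "0 < t0" using False v l by (simp add: t0_def)
    have "(\<lambda>N. v x + 1 / real (Suc N)) \<longlonglongrightarrow> v x + 0"
      by (intro tendsto_intros lim0)
    then have "t \<longlonglongrightarrow> t0"
      unfolding t_def t0_def using False l by (intro tendsto_intros) auto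
    moreover have "1 < exp 1 + t0" using t0 one_less_exp_iff[of "1::real"] by linarith
    ultimately have "(\<lambda>N. t N powr q * ln (exp 1 + t N) powr \<alpha>) \<longlonglongrightarrow> t0 powr q * ln (exp 1 + t0) powr \<alpha>"
      using t0 by (intro tendsto_intros) auto
    then have "(\<lambda>N. llog q \<alpha> (ennreal (t N))) \<longlonglongrightarrow> ennreal (t0 powr q * ln (exp 1 + t0) powr \<alpha>)"
      unfolding eq by (rule tendsto_ennrealI)
    moreover have "llog q \<alpha> (inv_root p v x / ennreal l) = ennreal (t0 powr q * ln (exp 1 + t0) powr \<alpha>)"
    proof -
      have "inv_root p v x / ennreal l = ennreal t0"
        using False l by (simp add: inv_root_def divide_ennreal t0_def)
      then show ?thesis using t0 by (simp add: llog_ennreal)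
    qed
    ultimately show ?thesis by (simp add: t_def)
  next
    case True
    have le: "real N powr (q / p) / l powr q \<le> t N powr q * ln (exp 1 + t N) powr \<alpha>" for N
    proof -
      have "t N = real (Suc N) powr (1 / p) / l"
        by (simp add: t_def True powr_divide powr_minus inverse_eq_divide)
      then have tq: "t N powr q = real (Suc N) powr (q / p) / l powr q" and t0: "0 \<le> t N"
        using l by (simp_all add: powr_divide powr_powr)
      have "1 \<le> ln (exp 1 + t N)"
        using t0 by (subst ln_ge_iff) (auto intro: add_pos_nonneg)
      then have "1 \<le> ln (exp 1 + t N) powr \<alpha>" using \<alpha> by (rule ge_one_powr_ge_zero)
      then have "t N powr q * 1 \<le> t N powr q * ln (exp 1 + t N) powr \<alpha>"
        by (intro mult_left_mono) auto
      moreover have "real N powr (q / p) / l powr q \<le> t N powr q"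
        unfolding tq using q p l by (intro divide_right_mono powr_mono2) auto
      ultimately show ?thesis by simp
    qed
    have lim: "filterlim (\<lambda>N. real N powr (q / p) / l powr q) at_top sequentially"
    proof -
      have "filterlim (\<lambda>y. exp (q / p * ln y)) at_top at_top"
        using q p by (intro filterlim_compose[OF exp_at_top] filterlim_tendsto_pos_mult_at_top[OF tendsto_const] ln_at_top) simp
      then have lim: "filterlim (\<lambda>N. exp (q / p * ln (real N))) at_top sequentially"
        by (rule filterlim_compose[OF _ filterlim_real_sequentially])
      have ev: "eventually (\<lambda>N. exp (q / p * ln (real N)) = real N powr (q / p)) sequentially"
        by (intro eventually_sequentiallyI[of 1]) (simp add: powr_def)
      have "filterlim (\<lambda>N. real N powr (q / p)) at_top sequentially"
        by (rule filterlim_cong[OF refl refl ev, THEN iffD1, OF lim])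
      then have "filterlim (\<lambda>N. (1 / l powr q) * real N powr (q / p)) at_top sequentially"
        using l by (intro filterlim_tendsto_pos_mult_at_top[OF tendsto_const]) auto
      then show ?thesis by simp
    qed
    have "filterlim (\<lambda>N. t N powr q * ln (exp 1 + t N) powr \<alpha>) at_top sequentially"
      by (rule filterlim_at_top_mono[OF lim always_eventually]) (rule allI, rule le)
    then have "(\<lambda>N. llog q \<alpha> (ennreal (t N))) \<longlonglongrightarrow> top"
      unfolding eq by (simp add: ennreal_tendsto_top_eq_at_top)
    moreover have "llog q \<alpha> (inv_root p v x / ennreal l) = top"
      using True by (simp add: inv_root_def ennreal_top_divide llog_def)
    ultimately show ?thesis by (simp add: t_def)
  qed
qed


section \<open>Testing the two-weight inequality\<close>

text \<open>The constant \<open>E\<close> is chosen before the cube, \<open>b\<close> and \<sigma>.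
  The bounds \<open>B\<close> and \<open>S\<close> make \<open>I\<close> finite and the test
  function admissible, but do not enter \<open>E\<close>. The condition on \<sigma> is the
  inequality form of the identity that v^(1 - p') satisfies.\<close>

theorem two_weight_testing:
  fixes T :: "(real ^ 'n \<Rightarrow> 'k) \<Rightarrow> real ^ 'n \<Rightarrow> 'k::{real_normed_field, banach, second_countable_topology}"
    and p p' C :: real
  assumes T: "nondegenerate_cz_operator T"
    and p: "p > 1" "1 / p + 1 / p' = 1"
    and u: "weight u" "doubling u" and v: "weight v"
    and bound: "\<And>b f. b \<in> BMO \<Longrightarrow> f \<in> bounded_compactly_supported \<Longrightarrow>
      weak_lp_norm p u (iter_commutator T b m f) \<le> ennreal C * bmo_norm b ^ m * lp_norm p v f"
  obtains E where "0 < E"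
    "\<And>a (h::real) b \<sigma> B S. 0 < h \<Longrightarrow> b \<in> BMO \<Longrightarrow> bmo_norm b \<le> ennreal (bmo_const CARD('n)) \<Longrightarrow>
      b \<in> borel_measurable lebesgue \<Longrightarrow> (\<And>x. b x \<le> B) \<Longrightarrow> (\<And>x. x \<in> cube a h \<Longrightarrow> 1 \<le> b x) \<Longrightarrow>
      (\<And>x. 4 * (CARD('n) * h) \<le> dist a x \<Longrightarrow> b x = 0) \<Longrightarrow>
      \<sigma> \<in> borel_measurable lebesgue \<Longrightarrow> (\<And>x. 0 < \<sigma> x) \<Longrightarrow> (\<And>x. \<sigma> x \<le> S) \<Longrightarrow>
      (\<And>x. \<sigma> x powr p * v x \<le> \<sigma> x) \<Longrightarrow>
      \<exists>I>0. (\<integral>\<^sup>+ x \<in> cube a h. ennreal (b x powr (m * p') * \<sigma> x) \<partial>lebesgue) = ennreal I \<and>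
        enn2real (wmeas u (cube a h)) powr (1 / p) * I powr (1 / p') \<le> E * h ^ CARD('n)"
proof -
  let ?n = "CARD('n)"
  note conj = conjugate_exponent[OF p]
  obtain \<kappa> \<Lambda> :: real where \<kappa>: "0 < \<kappa>"
    and far: "\<And>a (h::real). 0 < h \<Longrightarrow> \<exists>x0. 6 * (?n * h) \<le> dist a x0 \<and>
    dist a x0 \<le> \<Lambda> * h \<and>
    (\<forall>F B. F \<in> borel_measurable lebesgue \<longrightarrow> (\<forall>y. 0 \<le> F y \<and> F y \<le> B) \<longrightarrow> (\<forall>y. y \<notin> cube a h \<longrightarrow> F y = 0) \<longrightarrow>
      (AE x in lebesgue. x \<in> cube x0 h \<longrightarrow>
        \<kappa> / h ^ ?n * (LINT y|lebesgue. F y) \<le> norm (T (\<lambda>y. of_real (F y)) x)))"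
    using operator_lower_bound_far_cube[OF T] by blast
  obtain D :: real where D: "0 < D" "\<And>a x0 h. 0 < h \<Longrightarrow> dist a x0 \<le> \<Lambda> * h \<Longrightarrow>
    wmeas u (cube a h) \<le> ennreal D * wmeas u (cube x0 h)"
    using doubling_compare[OF u(2)] by blast
  \<comment> \<open>Positive whatever the sign of \<open>C\<close>; a negative \<open>C\<close>
    becomes 0 under \<open>ennreal\<close>.\<close>
  define C' where "C' = max C 1 * (bmo_const ?n ^ m + 1)"
  have C': "0 < C'" using bmo_const_nonneg[of ?n] by (auto simp: C'_def intro!: mult_pos_pos add_nonneg_pos)
  define E where "E = D powr (1 / p) * (2 * C' / \<kappa>)"
  show thesis
  proof (rule that[of E])
    show "0 < E" using D C' \<kappa> by (simp add: E_def)
    fix a :: "real ^ 'n" and h :: real and b \<sigma> :: "real ^ 'n \<Rightarrow> real" and B S :: real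
    assume h: "0 < h" and b: "b \<in> BMO" "bmo_norm b \<le> ennreal (bmo_const ?n)"
      and [measurable]: "b \<in> borel_measurable lebesgue" and bB: "\<And>x. b x \<le> B"
      and b1: "\<And>x. x \<in> cube a h \<Longrightarrow> 1 \<le> b x"
      and b0: "\<And>x. 4 * (?n * h) \<le> dist a x \<Longrightarrow> b x = 0"
      and [measurable]: "\<sigma> \<in> borel_measurable lebesgue" and \<sigma>: "\<And>x. 0 < \<sigma> x" "\<And>x. \<sigma> x \<le> S"
        "\<And>x. \<sigma> x powr p * v x \<le> \<sigma> x"
    let ?Q = "cube a h"
    \<comment> \<open>The exponent solves both balances at once: m + m (p' - 1) and m (p' - 1) p are
      both m p'. Hence \<open>b ^ m * f0\<close> and the bound for \<open>f0 powr p * v\<close> are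
      the same \<open>F\<close>.\<close>
    define f0 where "f0 x = indicat_real ?Q x * (b x powr (m * (p' - 1)) * \<sigma> x)" for x
    define F where "F x = indicat_real ?Q x * (b x powr (m * p') * \<sigma> x)" for x
    (* b >= 1 on Q matters even for m = 0, because 0 powr 0 = 0. *)
    have F_f0: "F x = b x ^ m * f0 x" for x
    proof (cases "x \<in> ?Q")
      case True
      have "b x powr (m * p') = b x powr (real m + m * (p' - 1))" by (simp add: algebra_simps)
      also have "\<dots> = b x ^ m * b x powr (m * (p' - 1))"
        using b1[OF True] by (simp add: powr_add powr_realpow)
      finally show ?thesis using True by (simp add: F_def f0_def)
    qed (simp add: F_def f0_def)
    have f0_p: "f0 x powr p * v x \<le> F x" for x
    proof (cases "x \<in> ?Q")
      case True
      have "f0 x powr p = b x powr (m * (p' - 1) * p) * \<sigma> x powr p"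
        using True b1[OF True] \<sigma>(1)[of x] by (simp add: f0_def powr_mult powr_powr)
      also have "m * (p' - 1) * p = m * p'" using conj(2) by (simp add: mult.assoc)
      finally have "f0 x powr p * v x = b x powr (m * p') * (\<sigma> x powr p * v x)" by simp
      also have "\<dots> \<le> b x powr (m * p') * \<sigma> x" using \<sigma>(3) by (intro mult_left_mono) auto
      finally show ?thesis using True by (simp add: F_def)
    qed (simp add: F_def f0_def)
    have [measurable]: "F \<in> borel_measurable lebesgue" "f0 \<in> borel_measurable lebesgue"
      unfolding F_def f0_def by (intro borel_measurable_times borel_measurable_indicator; measurable)+
    have S: "0 < S" using \<sigma> by (meson less_le_trans)
    have bd: "0 \<le> indicat_real ?Q x * (b x powr r * \<sigma> x) \<and>
        indicat_real ?Q x * (b x powr r * \<sigma> x) \<le> B powr r * S" if "0 \<le> r" for r x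
    proof (cases "x \<in> ?Q")
      case True
      have "b x powr r * \<sigma> x \<le> B powr r * S"
        using b1[OF True] bB[of x] \<sigma>(1,2)[of x] that by (intro mult_mono powr_mono2) auto
      then show ?thesis using True \<sigma>(1)[of x] by simp
    qed (use S in simp)
    have F_bd: "0 \<le> F x" "F x \<le> B powr (m * p') * S" for x
      using bd[of "m * p'" x] conj(1) by (auto simp: F_def)
    have f0_bd: "0 \<le> f0 x" "f0 x \<le> B powr (m * (p' - 1)) * S" for x
      using bd[of "m * (p' - 1)" x] conj(1) by (auto simp: f0_def)
    have F_supp: "F x = 0" if "x \<notin> ?Q" for x using that by (simp add: F_def)
    have intF: "integrable lebesgue F"
    proof (rule Bochner_Integration.integrable_bound)
      show "integrable lebesgue (\<lambda>y. indicat_real ?Q y * (B powr (m * p') * S))"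
        using cube_lmeasurable[OF h, of a] by (auto simp: fmeasurable_def)
      show "AE y in lebesgue. norm (F y) \<le> norm (indicat_real ?Q y * (B powr (m * p') * S))"
        using F_bd F_supp S by (intro AE_I2) (auto simp: indicator_def)
    qed measurable
    define I where "I = (LINT x|lebesgue. F x)"
    have nnI: "(\<integral>\<^sup>+ x. ennreal (F x) \<partial>lebesgue) = ennreal I"
      unfolding I_def using intF F_bd by (intro nn_integral_eq_integral) auto
    have I0: "0 < I"
    proof -
      have "0 \<le> I" unfolding I_def using F_bd by (intro integral_nonneg_AE) auto
      moreover have "I \<noteq> 0"
      proof
        assume "I = 0"
        then have "AE x in lebesgue. F x = 0"
          using integral_nonneg_eq_0_iff_AE[OF intF] F_bd by (simp add: I_def)
        moreover have "F x \<noteq> 0" if "x \<in> ?Q" for x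
          using that b1[OF that] \<sigma>(1)[of x] by (simp add: F_def)
        ultimately have "AE x in lebesgue. x \<notin> ?Q" by (auto elim: eventually_mono)
        then have "emeasure lebesgue ?Q = 0"
          by (simp add: AE_iff_measurable[of ?Q])
        then show False using h emeasure_cube[OF h, of a] by simp
      qed
      ultimately show ?thesis by simp
    qed
    have nnI': "(\<integral>\<^sup>+ x \<in> ?Q. ennreal (b x powr (m * p') * \<sigma> x) \<partial>lebesgue) = ennreal I"
      unfolding nnI[symmetric] F_def by (intro nn_integral_cong) (auto split: split_indicator)
    define f where "f x = (of_real (f0 x) :: 'k)" for x
    have f: "f \<in> bounded_compactly_supported"
    proof -
      have "f \<in> borel_measurable lebesgue" unfolding f_def by measurable
      moreover have "bounded (range f)"
        unfolding bounded_iff using f0_bd by (auto simp: f_def intro!: exI[of _ "B powr (m * (p' - 1)) * S"])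
      moreover have "compact (closure {x. f x \<noteq> 0})"
      proof -
        have "{x. f x \<noteq> 0} \<subseteq> cball a (?n * h)"
          using cube_subset_cball[OF corner_in_cube[OF h, of a]] by (auto simp: f_def f0_def indicator_def split: if_splits)
        then show ?thesis
          by (meson bounded_cball bounded_subset compact_closure)
      qed
      ultimately show ?thesis by (simp add: bounded_compactly_supported_def)
    qed
    have lp: "lp_norm p v f \<le> ennreal (I powr (1 / p))"
    proof -
      have "(\<integral>\<^sup>+ x. ennreal (norm (f x) powr p * v x) \<partial>lebesgue) \<le> ennreal I"
        unfolding nnI[symmetric] using f0_p f0_bd
        by (intro nn_integral_mono ennreal_leI) (simp add: f_def)
      then have "lp_norm p v f \<le> enn_powr (ennreal I) (1 / p)"
        unfolding lp_norm_def using p by (intro enn_powr_mono) auto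
      then show ?thesis using I0 by (simp add: enn_powr_ennreal)
    qed
    obtain x0 where x0: "6 * (?n * h) \<le> dist a x0" "dist a x0 \<le> \<Lambda> * h"
      and "\<forall>F B. F \<in> borel_measurable lebesgue \<longrightarrow> (\<forall>y. 0 \<le> F y \<and> F y \<le> B) \<longrightarrow> (\<forall>y. y \<notin> ?Q \<longrightarrow> F y = 0) \<longrightarrow>
      (AE x in lebesgue. x \<in> cube x0 h \<longrightarrow>
        \<kappa> / h ^ ?n * (LINT y|lebesgue. F y) \<le> norm (T (\<lambda>y. of_real (F y)) x))"
      using far[OF h] by blast
    then have ae: "AE x in lebesgue. x \<in> cube x0 h \<longrightarrow>
        \<kappa> / h ^ ?n * I \<le> norm (T (\<lambda>y. of_real (F y)) x)"
      unfolding I_def using F_bd F_supp by (metis (no_types, lifting) \<open>F \<in> borel_measurable lebesgue\<close>)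
    let ?P = "cube x0 h"
    \<comment> \<open>Half of the lower bound, since the weak norm is built from strict level
      sets.\<close>
    define s where "s = \<kappa> / h ^ ?n * I / 2"
    have s: "0 < s" using \<kappa> h I0 by (simp add: s_def)
    have "AE x in lebesgue. x \<in> ?P \<longrightarrow> s < norm (iter_commutator T b m f x)"
      using ae
    proof (rule AE_mp, intro AE_I2 impI)
      fix x assume *: "x \<in> ?P \<longrightarrow> \<kappa> / h ^ ?n * I \<le> norm (T (\<lambda>y. of_real (F y)) x)" and x: "x \<in> ?P"
      have "dist x0 x \<le> ?n * h" by (rule dist_cube_le[OF corner_in_cube[OF h] x])
      moreover have "dist a x0 \<le> dist a x + dist x0 x" by (metis dist_commute dist_triangle)
      moreover have "0 < ?n * h" using h by simp
      \<comment> \<open>The corner of the far cube is at least 6 n h from \<open>a\<close> and the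
        cube has diameter at most n h, which leaves more than the required 4 n h.\<close>
      ultimately have "b x = 0" using x0(1) by (intro b0) linarith
      then have "norm (iter_commutator T b m f x) = norm (T (\<lambda>y. of_real (F y)) x)"
        by (simp add: iter_commutator_at_zero norm_mult norm_power F_f0 f_def)
      moreover have "\<kappa> / h ^ ?n * I = 2 * s" by (simp add: s_def)
      then have "s < \<kappa> / h ^ ?n * I" using s by linarith
      ultimately show "s < norm (iter_commutator T b m f x)" using * x by simp
    qed
    then have "ennreal s * enn_powr (wmeas u ?P) (1 / p) \<le> weak_lp_norm p u (iter_commutator T b m f)"
      using s p by (intro weak_lp_norm_ge) auto
    also have "\<dots> \<le> ennreal C * bmo_norm b ^ m * lp_norm p v f"
      by (rule bound[OF b(1) f])
    also have "\<dots> \<le> ennreal C' * ennreal (I powr (1 / p))"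
    proof (intro mult_mono lp)
      have "ennreal C * bmo_norm b ^ m \<le> ennreal (max C 1) * ennreal (bmo_const ?n) ^ m"
        using b(2) by (intro mult_mono power_mono ennreal_leI) auto
      also have "\<dots> = ennreal (max C 1 * bmo_const ?n ^ m)"
        using bmo_const_nonneg[of ?n] by (simp add: ennreal_power ennreal_mult)
      also have "\<dots> \<le> ennreal C'"
        unfolding C'_def by (intro ennreal_leI mult_left_mono) auto
      finally show "ennreal C * bmo_norm b ^ m \<le> ennreal C'" .
    qed auto
    finally have weak: "ennreal s * enn_powr (wmeas u ?P) (1 / p) \<le> ennreal (C' * I powr (1 / p))"
      using C' by (simp add: ennreal_mult)
    define U where "U = enn2real (wmeas u ?P)"
    define V where "V = enn2real (wmeas u ?Q)"
    have U: "wmeas u ?P = ennreal U" "0 \<le> U" and V: "wmeas u ?Q = ennreal V" "0 \<le> V"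
      using wmeas_cube_finite[OF u(1) h, of x0] wmeas_cube_finite[OF u(1) h, of a] by (auto simp: U_def V_def)
    have "ennreal V \<le> ennreal (D * U)"
      using D(2)[OF h x0(2)] D(1) U V by (simp add: ennreal_mult)
    then have VU: "V \<le> D * U" using D U by simp
    have "ennreal (s * U powr (1 / p)) \<le> ennreal (C' * I powr (1 / p))"
      using weak U s by (simp add: enn_powr_ennreal ennreal_mult)
    then have "s * U powr (1 / p) \<le> C' * I powr (1 / p)"
      using C' by simp
    then have "\<kappa> * I * U powr (1 / p) \<le> 2 * C' * h ^ ?n * I powr (1 / p)"
      using h by (simp add: s_def field_simps)
    \<comment> \<open>Splitting \<open>I\<close> by the conjugate exponents allows the factor from
      the norm of \<open>f\<close> to be cancelled.\<close>
    moreover have "I = I powr (1 / p) * I powr (1 / p')"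
      using I0 p(2) by (simp add: powr_add[symmetric])
    ultimately have "I powr (1 / p) * (\<kappa> * (U powr (1 / p) * I powr (1 / p'))) \<le> I powr (1 / p) * (2 * C' * h ^ ?n)"
      by (metis (no_types, lifting) mult.assoc mult.commute)
    then have UI: "\<kappa> * (U powr (1 / p) * I powr (1 / p')) \<le> 2 * C' * h ^ ?n"
      using I0 by simp
    have "V powr (1 / p) \<le> (D * U) powr (1 / p)"
      using VU V p by (intro powr_mono2) auto
    also have "\<dots> = D powr (1 / p) * U powr (1 / p)" using D U by (simp add: powr_mult)
    finally have "V powr (1 / p) * I powr (1 / p') \<le> D powr (1 / p) * (U powr (1 / p) * I powr (1 / p'))"
      by (simp add: mult_right_mono mult.assoc[symmetric])
    also have "\<dots> \<le> D powr (1 / p) * (2 * C' * h ^ ?n / \<kappa>)"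
      using UI \<kappa> by (intro mult_left_mono) (auto simp: field_simps)
    also have "\<dots> = E * h ^ ?n" by (simp add: E_def)
    finally show "\<exists>I>0. (\<integral>\<^sup>+ x \<in> ?Q. ennreal (b x powr (m * p') * \<sigma> x) \<partial>lebesgue) = ennreal I \<and>
        enn2real (wmeas u ?Q) powr (1 / p) * I powr (1 / p') \<le> E * h ^ ?n"
      using I0 nnI' unfolding V_def by blast
  qed
qed


section \<open>From the testing inequality to the logarithmic bump\<close>

lemma ln_exp_1_add_le:
  fixes t \<beta> c :: real
  assumes "0 < c" "0 \<le> t" "1 \<le> \<beta>" "t \<le> 1 + exp \<beta> / c"
  shows "ln (exp 1 + t) \<le> (1 + ln (4 + 1 / c)) * \<beta>"
proof -
  have "exp 1 + t \<le> 4 * 1 + exp \<beta> / c" using assms exp_le by simp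
  also have "\<dots> \<le> 4 * exp \<beta> + exp \<beta> / c" using assms by (intro add_right_mono mult_left_mono) auto
  also have "\<dots> = (4 + 1 / c) * exp \<beta>" by (simp add: distrib_right)
  finally have "ln (exp 1 + t) \<le> ln ((4 + 1 / c) * exp \<beta>)"
    using assms by (intro ln_mono add_pos_nonneg) auto
  also have "\<dots> = ln (4 + 1 / c) + \<beta>"
    using assms by (subst ln_mult_pos) (auto intro!: add_pos_pos)
  \<comment> \<open>The additive constant is absorbed because \<beta> >= 1; this is what the bound b
    >= 1 on the cube is used for here.\<close>
  also have "\<dots> \<le> ln (4 + 1 / c) * \<beta> + \<beta>"
  proof -
    have "0 \<le> ln (4 + 1 / c)" using assms by (intro ln_ge_zero) simp
    then have "ln (4 + 1 / c) * 1 \<le> ln (4 + 1 / c) * \<beta>" using assms by (intro mult_left_mono) auto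
    then show ?thesis by simp
  qed
  finally show ?thesis by (simp add: algebra_simps)
qed

lemma le_one_add_powr:
  fixes s q :: real
  assumes "0 \<le> s" "1 \<le> q"
  shows "s \<le> 1 + s powr q"
proof (cases "s \<le> 1")
  case True
  then show ?thesis using powr_ge_zero[of s q] by linarith
next
  case False
  then have "s powr 1 \<le> s powr q" using assms by (intro powr_mono) auto
  then show ?thesis using False by simp
qed

theorem theorem1p5:
  fixes T :: "(real ^ 'n \<Rightarrow> 'k) \<Rightarrow> real ^ 'n \<Rightarrow> 'k::{real_normed_field, banach, second_countable_topology}"
    and m :: nat and p p' :: real and u v :: "real ^ 'n \<Rightarrow> real"
  assumes "nondegenerate_cz_operator T"
    and "p > 1" and "1 / p + 1 / p' = 1"
    and "weight u" and "weight v"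
    and "\<exists>C::real. \<forall>b\<in>BMO. \<forall>f\<in>bounded_compactly_supported.
           weak_lp_norm p u (iter_commutator T b m f) \<le> ennreal C * bmo_norm b ^ m * lp_norm p v f"
    and "doubling u"
  shows "(SUP Q\<in>cubes.
            luxemburg (\<lambda>t. enn_powr t p) Q (\<lambda>x. ennreal (u x powr (1 / p))) *
            luxemburg (llog p' (real m * p')) Q (inv_root p v)) < \<infinity>"
proof -
  let ?n = "CARD('n)"
  note p = assms(2,3)
  note conj = conjugate_exponent[OF p]
  have v0: "0 \<le> v x" for x using assms(5) by (simp add: weight_def)
  have [measurable]: "v \<in> borel_measurable lebesgue"
    using assms(5) by (simp add: weight_def locally_integrable_measurable)
  obtain C :: real where C: "\<And>b f. b \<in> BMO \<Longrightarrow> f \<in> bounded_compactly_supported \<Longrightarrow>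
      weak_lp_norm p u (iter_commutator T b m f) \<le> ennreal C * bmo_norm b ^ m * lp_norm p v f"
    using assms(6) by blast
  obtain E where E: "0 < E"
    "\<And>a (h::real) b \<sigma> B S. 0 < h \<Longrightarrow> b \<in> BMO \<Longrightarrow> bmo_norm b \<le> ennreal (bmo_const CARD('n)) \<Longrightarrow>
      b \<in> borel_measurable lebesgue \<Longrightarrow> (\<And>x. b x \<le> B) \<Longrightarrow> (\<And>x. x \<in> cube a h \<Longrightarrow> 1 \<le> b x) \<Longrightarrow>
      (\<And>x. 4 * (CARD('n) * h) \<le> dist a x \<Longrightarrow> b x = 0) \<Longrightarrow>
      \<sigma> \<in> borel_measurable lebesgue \<Longrightarrow> (\<And>x. 0 < \<sigma> x) \<Longrightarrow> (\<And>x. \<sigma> x \<le> S) \<Longrightarrow>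
      (\<And>x. \<sigma> x powr p * v x \<le> \<sigma> x) \<Longrightarrow>
      \<exists>I>0. (\<integral>\<^sup>+ x \<in> cube a h. ennreal (b x powr (m * p') * \<sigma> x) \<partial>lebesgue) = ennreal I \<and>
        enn2real (wmeas u (cube a h)) powr (1 / p) * I powr (1 / p') \<le> E * h ^ CARD('n)"
    using two_weight_testing[OF assms(1) p assms(4,7,5) C] by blast
  define c where "c = unit_ball_vol ?n / 2 * ?n ^ ?n"
  have c: "0 < c" by (simp add: c_def)
  define L where "L = 1 + ln (4 + 1 / c)"
  have L: "1 \<le> L" using c by (auto simp: L_def intro!: ln_ge_zero)
  (* Bounded approximations of v powr (1 - p'), which has to be read as infinity where v = 0;
     the passage to the limit is by Fatou's lemma. *)
  define \<sigma> where "\<sigma> N x = (v x + 1 / real (Suc N)) powr (1 - p')" for N x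
  have vN: "0 < v x + 1 / real (Suc N)" for N x using v0[of x] by (intro add_nonneg_pos) auto
  have \<sigma>0: "0 < \<sigma> N x" for N x using vN[of x N] by (simp add: \<sigma>_def)
  have \<sigma>meas [measurable]: "\<sigma> N \<in> borel_measurable lebesgue" for N
    unfolding \<sigma>_def by measurable
  have \<sigma>S: "\<sigma> N x \<le> (1 / real (Suc N)) powr (1 - p')" for N x
    unfolding \<sigma>_def using v0[of x] conj(1) by (intro powr_mono2') auto
  have \<sigma>v: "\<sigma> N x powr p * v x \<le> \<sigma> N x" for N x
  \<comment> \<open>Since (1 - p') (p - 1) = -1, raising \<sigma> to the power p multiplies it by
    the inverse of the regularised \<open>v\<close>, which dominates \<open>v\<close>.\<close>
  proof -
    have "\<sigma> N x powr p = \<sigma> N x * (v x + 1 / real (Suc N)) powr ((1 - p') * (p - 1))"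
      unfolding \<sigma>_def powr_powr using vN[of x N] by (simp add: powr_add[symmetric] algebra_simps)
    also have "\<dots> = \<sigma> N x / (v x + 1 / real (Suc N))"
      unfolding conj(3) using vN[of x N] by (simp add: powr_minus divide_inverse)
    finally have "\<sigma> N x powr p * v x = \<sigma> N x * (v x / (v x + 1 / real (Suc N)))" by simp
    also have "\<dots> \<le> \<sigma> N x * 1"
      using vN[of x N] \<sigma>0[of N x] by (intro mult_left_mono) (auto simp: divide_le_eq)
    finally show ?thesis by simp
  qed
  have \<sigma>_root: "\<sigma> N x powr (1 / p') = (v x + 1 / real (Suc N)) powr (- 1 / p)" for N x
    unfolding \<sigma>_def powr_powr using conj(4) by simp
  have key: "luxemburg (llog p' (m * p')) (cube a h) (inv_root p v)
      \<le> ennreal (L ^ m * (E * (h ^ ?n / enn2real (wmeas u (cube a h))) powr (1 / p)))"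
    if h: "0 < h" and V: "0 < enn2real (wmeas u (cube a h))" for a h
  proof -
    let ?Q = "cube a h"
    define V where "V = enn2real (wmeas u ?Q)"
    define v' where "v' = h ^ ?n"
    have V0: "0 < V" and v'0: "0 < v'" using V h by (auto simp: V_def v'_def)
    \<comment> \<open>The bound that testing predicts for the L^p' mean: solved for
      \<open>I\<close>, the testing inequality reads \<open>I \<le> K powr p' * v'\<close>.\<close>
    define K where "K = E * (v' / V) powr (1 / p)"
    have K: "0 < K" using E V0 v'0 by (simp add: K_def)
    have Kp: "K powr p' * v' = (E * v' / V powr (1 / p)) powr p'"
    proof -
      have "v' powr (1 / p * p') * v' = v' powr (1 / p * p' + 1)"
        using v'0 by (simp add: powr_add)
      also have "1 / p * p' + 1 = p'" using conj(2) p(1) by (simp add: field_simps)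
      finally show ?thesis
        using E(1) V0 v'0 by (simp add: K_def powr_mult powr_divide powr_powr)
    qed
    \<comment> \<open>The factor \<open>L ^ m\<close> is calibrated to cancel the power
      \<open>L powr (m * p')\<close> that the logarithm will produce.\<close>
    define l where "l = L ^ m * K"
    have lK: "K \<le> l" and l0: "0 < l" using L K by (auto simp: l_def one_le_power)
    have main: "(\<integral>\<^sup>+ y \<in> ?Q. llog p' (m * p') (ennreal ((v y + 1 / real (Suc N)) powr (- 1 / p) / l)) \<partial>lebesgue)
        \<le> ennreal v'" for N
    proof -
      define g where "g x = indicat_real ?Q x * \<sigma> N x" for x
      have gmeas: "g \<in> borel_measurable lebesgue"
        unfolding g_def by (intro borel_measurable_times borel_measurable_indicator; measurable)
      have g: "0 \<le> g x" "g x \<le> (1 / real (Suc N)) powr (1 - p')" "x \<notin> ?Q \<Longrightarrow> g x = 0" for x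
        using \<sigma>S[of N x] \<sigma>0[of N x] by (auto simp: g_def indicator_def)
      have "(\<integral>\<^sup>+ x. ennreal (g x) \<partial>lebesgue) \<le> (\<integral>\<^sup>+ x \<in> ?Q. ennreal ((1 / real (Suc N)) powr (1 - p')) \<partial>lebesgue)"
        using g by (intro nn_integral_mono) (auto split: split_indicator intro!: ennreal_leI)
      also have "\<dots> = ennreal ((1 / real (Suc N)) powr (1 - p') * v')"
        using h by (subst nn_integral_cmult_indicator) (auto simp: emeasure_lborel_cube v'_def ennreal_mult)
      finally have "(\<integral>\<^sup>+ x. ennreal (g x) \<partial>lebesgue) < top" by (meson ennreal_less_top order.strict_trans1)
      then obtain J where J: "0 \<le> J" "(\<integral>\<^sup>+ x. ennreal (g x) \<partial>lebesgue) = ennreal J"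
        by (cases "\<integral>\<^sup>+ x. ennreal (g x) \<partial>lebesgue") auto
      have "J \<noteq> 0"
      proof
        assume "J = 0"
        then have "AE x in lebesgue. ennreal (g x) = 0"
          using J gmeas by (simp add: nn_integral_0_iff_AE)
        moreover have "x \<notin> ?Q" if "ennreal (g x) = 0" for x
          using that \<sigma>0[of N x] by (auto simp: g_def)
        ultimately have "AE x in lebesgue. x \<notin> ?Q" by (auto elim: eventually_mono)
        then have "emeasure lebesgue ?Q = 0" by (simp add: AE_iff_measurable[of ?Q])
        then show False using h emeasure_cube[OF h, of a] by simp
      qed
      then have J0: "0 < J" using J by simp
      \<comment> \<open>The function \<open>b\<close> and its bound \<open>B\<close> change with
        \<open>N\<close>, but its BMO norm does not exceed \<open>bmo_const\<close>, so
        \<open>E\<close> is uniform in \<open>N\<close>.\<close>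
      obtain b B where b: "b \<in> BMO" "bmo_norm b \<le> ennreal (bmo_const ?n)"
        "b \<in> borel_measurable lebesgue" "\<And>x. 0 \<le> b x" "\<And>x. b x \<le> B"
        "\<And>x. x \<in> ?Q \<Longrightarrow> 1 \<le> b x" "\<And>x. 4 * (?n * h) \<le> dist a x \<Longrightarrow> b x = 0"
        "AE x in lebesgue. unit_ball_vol ?n / 2 * ?n ^ ?n * h ^ ?n * g x \<le> J * exp (b x)"
      proof (rule log_maximal_test_function[where a = a, OF gmeas g h J(2) J0], assumption)
        fix b B
        assume *: "b \<in> BMO" "bmo_norm b \<le> ennreal (bmo_const ?n)"
          "b \<in> borel_measurable lebesgue" "\<And>x. 0 \<le> b x" "\<And>x. b x \<le> B"
          "\<And>x. x \<in> ?Q \<Longrightarrow> 1 \<le> b x" "\<And>x. 4 * (?n * h) \<le> dist a x \<Longrightarrow> b x = 0"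
          "AE x in lebesgue. unit_ball_vol ?n / 2 * ?n ^ ?n * h ^ ?n * g x \<le> J * exp (b x)"
        show thesis by (rule that[OF *])
      qed
      note [measurable] = b(3)
      obtain I where I: "0 < I" "(\<integral>\<^sup>+ x \<in> ?Q. ennreal (b x powr (m * p') * \<sigma> N x) \<partial>lebesgue) = ennreal I"
        "V powr (1 / p) * I powr (1 / p') \<le> E * v'"
        using E(2)[OF h b(1-3,5-7) \<sigma>meas \<sigma>0 \<sigma>S \<sigma>v] unfolding V_def v'_def by blast
      have IK: "I \<le> K powr p' * v'"
      proof -
        have "I powr (1 / p') \<le> E * v' / V powr (1 / p)"
          using I(3) V0 by (simp add: field_simps)
        then have "(I powr (1 / p')) powr p' \<le> (E * v' / V powr (1 / p)) powr p'"
          using conj(1) by (intro powr_mono2) auto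
        then show ?thesis using I(1) conj(1) by (simp add: powr_powr Kp)
      qed
      \<comment> \<open>Because b >= 1 on the cube, testing also bounds the plain integral of
        \<sigma>. This lets \<open>K powr p'\<close> replace the mean of \<sigma> in the exponential
        estimate.\<close>
      have "ennreal J \<le> ennreal I"
        unfolding J(2)[symmetric] I(2)[symmetric]
      proof (rule nn_integral_mono)
        fix x
        show "ennreal (g x) \<le> ennreal (b x powr (m * p') * \<sigma> N x) * indicator ?Q x"
        proof (cases "x \<in> ?Q")
          case True
          have "1 \<le> b x powr (m * p')" using b(6)[OF True] conj(1) by (intro ge_one_powr_ge_zero) auto
          then have "1 * \<sigma> N x \<le> b x powr (m * p') * \<sigma> N x"
            using \<sigma>0[of N x] by (intro mult_right_mono) auto
          then show ?thesis using True by (simp add: g_def ennreal_leI)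
        qed (simp add: g_def)
      qed
      then have JK: "J \<le> K powr p' * v'" using IK I(1) by simp
      have pt: "AE y in lebesgue. llog p' (m * p') (ennreal ((v y + 1 / real (Suc N)) powr (- 1 / p) / l)) * indicator ?Q y
          \<le> ennreal (1 / K powr p') * (ennreal (b y powr (m * p') * \<sigma> N y) * indicator ?Q y)"
        using b(8)
      proof (rule AE_mp, intro AE_I2 impI)
        fix y assume le: "unit_ball_vol ?n / 2 * ?n ^ ?n * h ^ ?n * g y \<le> J * exp (b y)"
        show "llog p' (m * p') (ennreal ((v y + 1 / real (Suc N)) powr (- 1 / p) / l)) * indicator ?Q y
          \<le> ennreal (1 / K powr p') * (ennreal (b y powr (m * p') * \<sigma> N y) * indicator ?Q y)"
        proof (cases "y \<in> ?Q")
          case True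
          define t where "t = \<sigma> N y powr (1 / p') / l"
          have t: "0 \<le> t" using l0 by (simp add: t_def)
          have tK: "t \<le> \<sigma> N y powr (1 / p') / K"
            unfolding t_def using lK K by (intro divide_left_mono) auto
          \<comment> \<open>The estimate for \<open>exp (b y)\<close> concerns \<sigma> itself, so
            the root is first compared with its p'-th power, at the cost of an additive 1.\<close>
          have "\<sigma> N y powr (1 / p') / K \<le> 1 + (\<sigma> N y powr (1 / p') / K) powr p'"
            using K conj(1) by (intro le_one_add_powr) auto
          also have "(\<sigma> N y powr (1 / p') / K) powr p' = \<sigma> N y / K powr p'"
            using K conj(1) \<sigma>0[of N y] by (simp add: powr_divide powr_powr)
          also have "\<sigma> N y / K powr p' \<le> exp (b y) / c"
          proof -
            have "c * v' * \<sigma> N y \<le> J * exp (b y)" using le True by (simp add: c_def v'_def g_def)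
            also have "\<dots> \<le> K powr p' * v' * exp (b y)" using JK by (intro mult_right_mono) auto
            finally have "v' * (c * \<sigma> N y) \<le> v' * (K powr p' * exp (b y))" by (simp add: mult_ac)
            then have "c * \<sigma> N y \<le> K powr p' * exp (b y)" using v'0 by simp
            then show ?thesis using c K by (simp add: field_simps)
          qed
          finally have "t \<le> 1 + exp (b y) / c" using tK by simp
          then have ln_le: "ln (exp 1 + t) \<le> L * b y"
            unfolding L_def using c t b(6)[OF True] by (intro ln_exp_1_add_le) auto
          have "0 \<le> ln (exp 1 + t)" using t by (intro ln_ge_zero) (simp add: add_increasing2)
          then have "ln (exp 1 + t) powr (m * p') \<le> (L * b y) powr (m * p')"
            using ln_le conj(1) by (intro powr_mono2) auto
          also have "\<dots> = L powr (m * p') * b y powr (m * p')"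
            using L b(4)[of y] by (simp add: powr_mult)
          finally have "t powr p' * ln (exp 1 + t) powr (m * p') \<le> t powr p' * (L powr (m * p') * b y powr (m * p'))"
            by (intro mult_left_mono) auto
          also have "\<dots> = 1 / K powr p' * (b y powr (m * p') * \<sigma> N y)"
          proof -
            have "t powr p' = \<sigma> N y / (L powr (m * p') * K powr p')"
              using K L conj(1) \<sigma>0[of N y]
              by (simp add: t_def l_def powr_divide powr_mult powr_powr powr_realpow[symmetric])
            then show ?thesis using L by simp
          qed
          finally have "ennreal (t powr p' * ln (exp 1 + t) powr (m * p'))
              \<le> ennreal (1 / K powr p' * (b y powr (m * p') * \<sigma> N y))"
            by (rule ennreal_leI)
          also have "\<dots> = ennreal (1 / K powr p') * ennreal (b y powr (m * p') * \<sigma> N y)"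
            using \<sigma>0[of N y] by (intro ennreal_mult) auto
          finally show ?thesis
            using True t by (simp only: \<sigma>_root[symmetric] t_def[symmetric] llog_ennreal) simp
        qed simp
      qed
      have "(\<integral>\<^sup>+ y \<in> ?Q. llog p' (m * p') (ennreal ((v y + 1 / real (Suc N)) powr (- 1 / p) / l)) \<partial>lebesgue)
        \<le> (\<integral>\<^sup>+ y. ennreal (1 / K powr p') * (ennreal (b y powr (m * p') * \<sigma> N y) * indicator ?Q y) \<partial>lebesgue)"
        by (rule nn_integral_mono_AE[OF pt])
      also have "\<dots> = ennreal (1 / K powr p') * ennreal I"
        unfolding I(2)[symmetric]
        by (intro nn_integral_cmult borel_measurable_times_ennreal borel_measurable_indicator) auto
      also have "\<dots> = ennreal (1 / K powr p' * I)" using I(1) by (intro ennreal_mult[symmetric]) auto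
      also have "\<dots> \<le> ennreal v'"
        using IK K by (intro ennreal_leI) (simp add: field_simps)
      finally show ?thesis .
    qed
    have meas: "(\<lambda>y. llog p' (m * p') (ennreal ((v y + 1 / real (Suc N)) powr (- 1 / p) / l)) * indicator ?Q y)
        \<in> borel_measurable lebesgue" for N
    proof -
      have "llog p' (m * p') (ennreal ((v y + 1 / real (Suc N)) powr (- 1 / p) / l)) =
        ennreal (((v y + 1 / real (Suc N)) powr (- 1 / p) / l) powr p' *
          ln (exp 1 + (v y + 1 / real (Suc N)) powr (- 1 / p) / l) powr (m * p'))" for y
        using l0 by (intro llog_ennreal) simp
      then show ?thesis
        by (simp only:) (intro borel_measurable_times_ennreal borel_measurable_indicator; measurable)
    qed
    \<comment> \<open>The limit is taken pointwise with the value infinity allowed, so the finite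
      bound obtained below also forces \<open>v > 0\<close> almost everywhere on the cube.\<close>
    have "(\<integral>\<^sup>+ y \<in> ?Q. llog p' (m * p') (inv_root p v y / ennreal l) \<partial>lebesgue)
        = (\<integral>\<^sup>+ y. liminf (\<lambda>N. llog p' (m * p') (ennreal ((v y + 1 / real (Suc N)) powr (- 1 / p) / l)) * indicator ?Q y) \<partial>lebesgue)"
    proof (rule nn_integral_cong)
      fix y
      have "(\<lambda>N. llog p' (m * p') (ennreal ((v y + 1 / real (Suc N)) powr (- 1 / p) / l)))
          \<longlonglongrightarrow> llog p' (m * p') (inv_root p v y / ennreal l)"
        using v0 l0 p(1) conj(1) by (intro llog_inv_root_tendsto) auto
      from lim_imp_Liminf[OF _ this]
      show "llog p' (m * p') (inv_root p v y / ennreal l) * indicator ?Q y =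
          liminf (\<lambda>N. llog p' (m * p') (ennreal ((v y + 1 / real (Suc N)) powr (- 1 / p) / l)) * indicator ?Q y)"
        by (cases "y \<in> ?Q") (simp_all add: Liminf_const)
    qed
    also have "\<dots> \<le> liminf (\<lambda>N. \<integral>\<^sup>+ y \<in> ?Q. llog p' (m * p') (ennreal ((v y + 1 / real (Suc N)) powr (- 1 / p) / l)) \<partial>lebesgue)"
      by (rule nn_integral_liminf[OF meas])
    also have "\<dots> \<le> liminf (\<lambda>N::nat. ennreal v')"
      by (intro Liminf_mono always_eventually allI main)
    also have "\<dots> = ennreal v'" by (simp add: Liminf_const)
    finally have "enn_avg (\<lambda>y. llog p' (m * p') (inv_root p v y / ennreal l)) ?Q \<le> 1"
      using enn_avg_cube_le_iff[OF h, of 1 _ a] by (simp add: v'_def)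
    then show ?thesis
      using luxemburg_le[OF l0] unfolding l_def K_def V_def v'_def by blast
  qed
  have "luxemburg (\<lambda>t. enn_powr t p) Q (\<lambda>x. ennreal (u x powr (1 / p))) *
        luxemburg (llog p' (real m * p')) Q (inv_root p v) \<le> ennreal (L ^ m * E)" if "Q \<in> cubes" for Q
  proof -
    obtain a h where Q: "Q = cube a h" "0 < h" using \<open>Q \<in> cubes\<close> by (auto simp: cubes_def)
    define V where "V = enn2real (wmeas u Q)"
    have V: "wmeas u Q = ennreal V" "0 \<le> V"
      using wmeas_cube_finite[OF assms(4) Q(2), of a] Q(1) by (auto simp: V_def)
    note lux_u = luxemburg_powr_le[OF assms(4) _ Q(2), of p _ a, folded Q(1)]
    show ?thesis
    proof (cases "V = 0")
      case True
      \<comment> \<open>With \<open>u(Q) = 0\<close> the first factor is 0, and the product vanishes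
        even if the second factor is infinite.\<close>
      have eps: "luxemburg (\<lambda>t. enn_powr t p) Q (\<lambda>x. ennreal (u x powr (1 / p))) \<le> 0 + ennreal e" if "0 < e" for e
        using lux_u[of e] p(1) that V True by simp
      have "luxemburg (\<lambda>t. enn_powr t p) Q (\<lambda>x. ennreal (u x powr (1 / p))) \<le> 0"
        by (rule ennreal_le_epsilon) (rule eps)
      then show ?thesis by simp
    next
      case False
      then have V0: "0 < V" using V by simp
      have hn: "0 < h ^ ?n" using Q by simp
      \<comment> \<open>The L^p mean of u^(1/p); it is reciprocal to the power of |Q| / u(Q) in
        \<open>key\<close>, so the product no longer depends on the cube.\<close>
      define l where "l = (V / h ^ ?n) powr (1 / p)"
      have l: "0 < l" using V0 Q by (simp add: l_def)
      have "h ^ ?n * l powr p = V"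
        using V0 hn Q(2) p(1) by (simp add: l_def powr_powr)
      then have 1: "luxemburg (\<lambda>t. enn_powr t p) Q (\<lambda>x. ennreal (u x powr (1 / p))) \<le> ennreal l"
        using lux_u[of l] p(1) l V by simp
      have 2: "luxemburg (llog p' (m * p')) Q (inv_root p v) \<le> ennreal (L ^ m * (E * (h ^ ?n / V) powr (1 / p)))"
        using key[OF Q(2), of a] V0 unfolding V_def Q(1) by simp
      have "l * (h ^ ?n / V) powr (1 / p) = 1"
        using V0 hn Q(2) by (simp add: l_def powr_mult[symmetric])
      then have eq: "l * (L ^ m * (E * (h ^ ?n / V) powr (1 / p))) = L ^ m * E"
        by (simp add: mult.left_commute)
      have "luxemburg (\<lambda>t. enn_powr t p) Q (\<lambda>x. ennreal (u x powr (1 / p))) *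
        luxemburg (llog p' (real m * p')) Q (inv_root p v)
        \<le> ennreal l * ennreal (L ^ m * (E * (h ^ ?n / V) powr (1 / p)))"
        by (intro mult_mono 1 2) auto
      also have "\<dots> = ennreal (L ^ m * E)"
        using l L E(1) by (subst ennreal_mult[symmetric]) (auto simp: eq)
      finally show ?thesis .
    qed
  qed
  then have "(SUP Q\<in>cubes.
            luxemburg (\<lambda>t. enn_powr t p) Q (\<lambda>x. ennreal (u x powr (1 / p))) *
            luxemburg (llog p' (real m * p')) Q (inv_root p v)) \<le> ennreal (L ^ m * E)"
    by (intro SUP_least)
  then show ?thesis
    using ennreal_less_top order.strict_trans1 unfolding infinity_ennreal_def by blast
qed

end
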